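(* Let $n\ge 1$, $0<s<1$, let $D\subset\mathbb{R}^n$ be a bounded domain and let $0<\beta<|D|$. Then there exists a unique minimizer $\hat f$ of $\Phi_s$ over $\bar{\mathcal R}_\beta$, i.e. a unique $\hat f\in\bar{\mathcal R}_\beta$ such that $$\Phi_s(\hat f)\le \Phi_s(f)\quad\text{for every } f\in\bar{\mathcal R}_\beta,$$ and this minimizer satisfies $\hat f\in\bar{\mathcal R}_\beta\setminus\mathcal R_\beta$. Moreover, for some $\alpha>0$ the function $\hat u=u_{\hat f}$ satisfies $$\{\hat f<1\}\subset\{\hat u=\alpha\},\qquad \{\hat u<\alpha\}\subset\{\hat f=1\},\qquad \hat f>0 \ \text{ in } D,\qquad 0\le \hat u\le\alpha\ \text{ in } D.$$
   Context: Notation: $|u|_s^2:=\iint_{\mathbb{R}^{2n}}\frac{|u(x)-u(y)|^2}{|x-y|^{n+2s}}\,dx\,dy$; $H^s(\mathbb{R}^n)=\{v\in L^2(\mathbb{R}^n): |v|_s^2<\infty\}$; $H^s_0(D)=\{v\in H^s(\mathbb{R}^n): v=0 \text{ a.e. in } D^c\}$, where $D^c=\mathbb{R}^n\setminus D$. For $f\in L^2(D)$, $u_f\in H^s_0(D)$ denotes the unique weak solution of $(-\Delta)^s u_f=f$ in $D$, $u_f=0$ in $D^c$, i.e. the unique $u_f\in H^s_0(D)$ with $$\frac12\iint_{\mathbb{R}^{2n}}\frac{(u_f(x)-u_f(y))(v(x)-v(y))}{|x-y|^{n+2s}}\,dx\,dy=\int_D f v\,dx\quad\text{for all } v\in H^s_0(D).$$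 The functional is $\Phi_s(f):=|u_f|_s^2$. The admissible sets are $\bar{\mathcal R}_\beta=\{f\in L^\infty(D): 0\le f\le 1,\ \int_D f\,dx=\beta\}$ and $\mathcal R_\beta=\{f\in L^\infty(D): f=\chi_E,\ E\subset D \text{ measurable},\ |E|=\beta\}$. Functions are identified when equal a.e.; level sets such as $\{\hat f<1\}$ are subsets of $D$, and the inclusions and pointwise inequalities are understood up to Lebesgue-null sets. *)

theory Defs
  imports "HOL-Analysis.Analysis"
begin

text \<open>
  Throughout, \<open>\<real>\<^sup>n\<close> is a type \<open>'a :: euclidean_space\<close> with \<open>n = DIM('a)\<close>, and
  \<open>\<real>\<^sup>2\<^sup>n\<close> is the product type \<open>'a \<times> 'a\<close> with its own Lebesgue measure.
  Elements of function spaces are represented by functions; \<open>f x\<close> for \<open>x \<notin> D\<close> is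
  irrelevant when \<open>f\<close> represents an element of a space over \<open>D\<close>. Equality of such
  elements is equality almost everywhere.
\<close>

definition gagliardo_sq :: "real \<Rightarrow> ('a::euclidean_space \<Rightarrow> real) \<Rightarrow> ennreal"
  where "gagliardo_sq s u =
    (\<integral>\<^sup>+ (x, y). ennreal (\<bar>u x - u y\<bar>\<^sup>2 / norm (x - y) powr (real DIM('a) + 2 * s))
      \<partial>(lebesgue :: ('a \<times> 'a) measure))"

definition gagliardo_form :: "real \<Rightarrow> ('a::euclidean_space \<Rightarrow> real) \<Rightarrow> ('a \<Rightarrow> real) \<Rightarrow> real"
  where "gagliardo_form s u v =
    (\<integral> (x, y). (u x - u y) * (v x - v y) / norm (x - y) powr (real DIM('a) + 2 * s)
      \<partial>(lebesgue :: ('a \<times> 'a) measure))"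

definition Hs :: "real \<Rightarrow> ('a::euclidean_space \<Rightarrow> real) set"
  where "Hs s = {v. v \<in> borel_measurable lebesgue \<and> integrable lebesgue (\<lambda>x. (v x)\<^sup>2)
    \<and> gagliardo_sq s v < \<infinity>}"

definition Hs0 :: "real \<Rightarrow> 'a::euclidean_space set \<Rightarrow> ('a \<Rightarrow> real) set"
  where "Hs0 s D = {v \<in> Hs s. AE x in lebesgue. x \<notin> D \<longrightarrow> v x = 0}"

definition weak_solution ::
    "real \<Rightarrow> 'a::euclidean_space set \<Rightarrow> ('a \<Rightarrow> real) \<Rightarrow> ('a \<Rightarrow> real) \<Rightarrow> bool"
  where "weak_solution s D f u \<longleftrightarrow> u \<in> Hs0 s D \<and>
    (\<forall>v \<in> Hs0 s D. 1 / 2 * gagliardo_form s u v = (\<integral>x. f x * v x \<partial>lebesgue_on D))"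

text \<open>
  The weak solution is unique only up to null sets, so \<open>u\<^sub>f\<close> is a chosen representative.
\<close>

definition solution :: "real \<Rightarrow> 'a::euclidean_space set \<Rightarrow> ('a \<Rightarrow> real) \<Rightarrow> 'a \<Rightarrow> real"
  where "solution s D f = (SOME u. weak_solution s D f u)"

definition Phi :: "real \<Rightarrow> 'a::euclidean_space set \<Rightarrow> ('a \<Rightarrow> real) \<Rightarrow> ennreal"
  where "Phi s D f = gagliardo_sq s (solution s D f)"

definition Linfty :: "'a::euclidean_space set \<Rightarrow> ('a \<Rightarrow> real) set"
  where "Linfty D = {f \<in> borel_measurable (lebesgue_on D).
    \<exists>C. AE x in lebesgue_on D. \<bar>f x\<bar> \<le> C}"

definition Rbar :: "'a::euclidean_space set \<Rightarrow> real \<Rightarrow> ('a \<Rightarrow> real) set"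
  where "Rbar D \<beta> = {f \<in> Linfty D. (AE x in lebesgue_on D. 0 \<le> f x \<and> f x \<le> 1)
    \<and> (\<integral>x. f x \<partial>lebesgue_on D) = \<beta>}"

definition Rchar :: "'a::euclidean_space set \<Rightarrow> real \<Rightarrow> ('a \<Rightarrow> real) set"
  where "Rchar D \<beta> = {f \<in> Linfty D. \<exists>E \<in> sets lebesgue. E \<subseteq> D \<and> measure lebesgue E = \<beta>
    \<and> (AE x in lebesgue_on D. f x = indicator E x)}"

definition minimizer :: "real \<Rightarrow> 'a::euclidean_space set \<Rightarrow> real \<Rightarrow> ('a \<Rightarrow> real) \<Rightarrow> bool"
  where "minimizer s D \<beta> f \<longleftrightarrow> f \<in> Rbar D \<beta> \<and> (\<forall>g \<in> Rbar D \<beta>. Phi s D f \<le> Phi s D g)"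

end

theory Submission
  imports Defs
begin

text \<open>
  \<open>\<Phi>\<close> is the square of a Hilbert seminorm in the linear quantity \<open>u\<^sub>f\<close>, so it is convex, and a
  vanishing increment of \<open>u\<^sub>f\<close> forces a vanishing increment of \<open>f\<close>; this gives uniqueness.
  Since \<open>\<Phi>(f) = 2 \<integral> f u\<^sub>f\<close>, the first variation says that the minimizer \<open>f\<close> minimizes
  \<open>g \<mapsto> \<integral> g u\<^sub>f\<close> over the admissible set, so by the bathtub principle there is a level \<open>\<alpha>\<close> with
  \<open>f = 1\<close> on \<open>{u\<^sub>f < \<alpha>}\<close> and \<open>f = 0\<close> on \<open>{u\<^sub>f > \<alpha>}\<close>. Testing the equation with \<open>(u\<^sub>f - \<alpha>)\<^sup>+\<close> shows that
  the latter set is null. On the contact set \<open>{u\<^sub>f = \<alpha>}\<close> the function \<open>u\<^sub>f\<close> is maximal, and the fractional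
  Laplacian there is at least the interaction with a region where \<open>u\<^sub>f = 0\<close>; hence \<open>f\<close> is bounded
  below by a positive constant there, and in particular \<open>f\<close> is not a characteristic function.
\<close>

text \<open>Functions are known only up to null sets, so the fractional Laplacian of u_f is never
  evaluated at a point: the bounds on u_f and the lower bound on f all come from test functions in
  the weak equation. This needs \<open>Hs0 s D\<close> to be rich. Cut-offs of the distance to a
  closed set lie in it (here s < 1 matters), and by way of open sets they detect the sign of any
  bounded function almost everywhere. That is why u_f = 0 forces f = 0, and why an integrated
  inequality on the contact set becomes a pointwise bound for f. The nonlocal input is always the
  same: some ball \<open>A\<close> disjoint from D lies within bounded distance of all points of D,
  and every function of \<open>Hs0 s D\<close> vanishes on it. Keeping only the interaction of D
  with \<open>A\<close> in the double integral yields the Poincare constant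
  \<open>1 / (\<kappa> * m)\<close> as well as the positive bound
  \<open>\<kappa> * \<alpha> * m / 2\<close> for f on the contact set, where m = |A|. The level
  \<open>\<alpha>\<close> cannot be 0: then u_f, and with it f, would vanish, against \<beta> >
  0.\<close>

section \<open>Lebesgue measure on products and \<open>L\<^sup>2\<close> convergence\<close>

text \<open>Lebesgue measure on the product completes
  \<open>lborel \<Otimes>\<^sub>M lborel\<close>; it is not the product of the completions. Null
  sets are therefore moved through a Borel null set \<open>N\<close>, whose cylinder is null
  although the other factor has infinite measure.\<close>

lemma AE_lebesgue_fst:
  assumes "AE x in (lebesgue :: 'a::euclidean_space measure). P x"
  shows "AE z in (lebesgue :: ('a \<times> 'b::euclidean_space) measure). P (fst z)"
proof -
  have "AE x in (lborel :: 'a measure). P x"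
    using assms by (simp add: AE_completion_iff)
  then obtain N where N: "{x. \<not> P x} \<subseteq> N" "N \<in> null_sets lborel"
    unfolding eventually_ae_filter by auto
  have "N \<times> (UNIV :: 'b set) \<in> null_sets lborel"
    using N(2) by (auto simp: null_sets_def lborel_prod[symmetric] lborel.emeasure_pair_measure_Times)
  then have "AE z in (lborel :: ('a \<times> 'b) measure). z \<notin> N \<times> UNIV"
    by (rule AE_not_in)
  then have "AE z in (lborel :: ('a \<times> 'b) measure). P (fst z)"
    by eventually_elim (use N(1) in auto)
  then show ?thesis by (rule AE_completion)
qed

lemma AE_lebesgue_snd:
  assumes "AE x in (lebesgue :: 'b::euclidean_space measure). P x"
  shows "AE z in (lebesgue :: ('a::euclidean_space \<times> 'b) measure). P (snd z)"
proof -
  have "AE x in (lborel :: 'b measure). P x"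
    using assms by (simp add: AE_completion_iff)
  then obtain N where N: "{x. \<not> P x} \<subseteq> N" "N \<in> null_sets lborel"
    unfolding eventually_ae_filter by auto
  have "(UNIV :: 'a set) \<times> N \<in> null_sets lborel"
    using N(2) by (auto simp: null_sets_def lborel_prod[symmetric] lborel.emeasure_pair_measure_Times)
  then have "AE z in (lborel :: ('a \<times> 'b) measure). z \<notin> UNIV \<times> N"
    by (rule AE_not_in)
  then have "AE z in (lborel :: ('a \<times> 'b) measure). P (snd z)"
    by eventually_elim (use N(1) in auto)
  then show ?thesis by (rule AE_completion)
qed

lemma borel_measurable_lebesgue_AE_borel:
  fixes u :: "'a::euclidean_space \<Rightarrow> real"
  assumes "u \<in> borel_measurable lebesgue"
  obtains v where "v \<in> borel_measurable borel" "AE x in lebesgue. u x = v x"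
  using completion_ex_borel_measurable_real[OF assms] by (auto simp: AE_completion_iff)

lemma borel_measurable_lebesgue_cong_AE:
  fixes u v :: "'a::euclidean_space \<Rightarrow> real"
  assumes "v \<in> borel_measurable lebesgue" "AE x in lebesgue. u x = v x"
  shows "u \<in> borel_measurable lebesgue"
proof (rule measurableI)
  fix S :: "real set" assume S: "S \<in> sets borel"
  have 1: "v -` S \<in> sets lebesgue"
    using measurable_sets[OF assms(1) S] by simp
  have 2: "AE x in lebesgue. x \<in> v -` S \<longleftrightarrow> x \<in> u -` S"
    using assms(2) by eventually_elim auto
  have "u -` S \<in> sets lebesgue"
    by (rule complete_measure.in_sets_AE[OF completion.complete_measure_axioms 2 1]) simp
  then show "u -` S \<inter> space lebesgue \<in> sets lebesgue" by simp
qed auto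

lemma borel_measurable_lebesgue_fst:
  fixes u :: "'a::euclidean_space \<Rightarrow> real"
  assumes "u \<in> borel_measurable lebesgue"
  shows "(\<lambda>z. u (fst z)) \<in> borel_measurable (lebesgue :: ('a \<times> 'b::euclidean_space) measure)"
proof -
  obtain v where [measurable]: "v \<in> borel_measurable borel" and v: "AE x in lebesgue. u x = v x"
    using borel_measurable_lebesgue_AE_borel[OF assms] .
  have "(\<lambda>z. v (fst z)) \<in> borel_measurable (lborel :: ('a \<times> 'b) measure)"
    unfolding lborel_prod[symmetric] by measurable
  then have "(\<lambda>z. v (fst z)) \<in> borel_measurable (lebesgue :: ('a \<times> 'b) measure)"
    by (rule measurable_completion)
  then show ?thesis
    using AE_lebesgue_fst[OF v] by (rule borel_measurable_lebesgue_cong_AE)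
qed

lemma borel_measurable_lebesgue_snd:
  fixes u :: "'b::euclidean_space \<Rightarrow> real"
  assumes "u \<in> borel_measurable lebesgue"
  shows "(\<lambda>z. u (snd z)) \<in> borel_measurable (lebesgue :: ('a::euclidean_space \<times> 'b) measure)"
proof -
  obtain v where [measurable]: "v \<in> borel_measurable borel" and v: "AE x in lebesgue. u x = v x"
    using borel_measurable_lebesgue_AE_borel[OF assms] .
  have "(\<lambda>z. v (snd z)) \<in> borel_measurable (lborel :: ('a \<times> 'b) measure)"
    unfolding lborel_prod[symmetric] by measurable
  then have "(\<lambda>z. v (snd z)) \<in> borel_measurable (lebesgue :: ('a \<times> 'b) measure)"
    by (rule measurable_completion)
  then show ?thesis
    using AE_lebesgue_snd[OF v] by (rule borel_measurable_lebesgue_cong_AE)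
qed

text \<open>The instance of Tonelli that evaluates the interaction of a function with a fixed set;
  passing to a Borel representative of \<open>g\<close> brings the integral back to
  \<open>lborel \<Otimes>\<^sub>M lborel\<close>.\<close>

lemma nn_integral_lebesgue_Times_indicator:
  fixes g :: "'a::euclidean_space \<Rightarrow> real" and A :: "'b::euclidean_space set"
  assumes "g \<in> borel_measurable lebesgue" and A[measurable]: "A \<in> sets borel"
  shows "(\<integral>\<^sup>+ z. ennreal (g (fst z)) * indicator A (snd z) \<partial>lebesgue)
    = (\<integral>\<^sup>+ x. ennreal (g x) \<partial>lebesgue) * emeasure lebesgue A"
proof -
  obtain v where [measurable]: "v \<in> borel_measurable borel" and v: "AE x in lebesgue. g x = v x"
    using borel_measurable_lebesgue_AE_borel[OF assms(1)] .
  have "(\<integral>\<^sup>+ z. ennreal (g (fst z)) * indicator A (snd z) \<partial>lebesgue)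
      = (\<integral>\<^sup>+ z. ennreal (v (fst z)) * indicator A (snd z) \<partial>lebesgue)"
    using AE_lebesgue_fst[OF v] by (intro nn_integral_cong_AE) auto
  also have "\<dots> = (\<integral>\<^sup>+ z. ennreal (v (fst z)) * indicator A (snd z) \<partial>(lborel \<Otimes>\<^sub>M lborel))"
    by (simp add: nn_integral_completion lborel_prod)
  also have "\<dots> = (\<integral>\<^sup>+ x. \<integral>\<^sup>+ y. ennreal (v x) * indicator A y \<partial>lborel \<partial>lborel)"
    by (subst lborel.nn_integral_fst[symmetric]) simp_all
  also have "\<dots> = (\<integral>\<^sup>+ x. ennreal (v x) \<partial>lborel) * emeasure lborel A"
    by (simp add: nn_integral_cmult nn_integral_multc)
  also have "(\<integral>\<^sup>+ x. ennreal (v x) \<partial>lborel) = (\<integral>\<^sup>+ x. ennreal (g x) \<partial>lebesgue)"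
  proof -
    have "(\<integral>\<^sup>+ x. ennreal (g x) \<partial>lebesgue) = (\<integral>\<^sup>+ x. ennreal (v x) \<partial>lebesgue)"
      using v by (intro nn_integral_cong_AE) auto
    then show ?thesis by (simp add: nn_integral_completion)
  qed
  finally show ?thesis using A by simp
qed

text \<open>The discriminant criterion. It gives Cauchy-Schwarz for the Gagliardo form and for L^2,
  and later turns near-minimality into a bound on the residual of the weak equation.\<close>

lemma real_quadratic_nonneg_bound:
  fixes a b c :: real
  assumes "\<And>t. 0 \<le> a + 2 * t * b + t\<^sup>2 * c"
  shows "b\<^sup>2 \<le> a * c"
proof (cases "c = 0")
  case True
  have "b = 0"
  proof (rule ccontr)
    assume "b \<noteq> 0"
    with assms[of "- (a + 1) / (2 * b)"] True show False by (simp add: field_simps)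
  qed
  with True show ?thesis by simp
next
  case False
  have "c > 0"
  proof (rule ccontr)
    assume "\<not> c > 0"
    with False have c: "c < 0" by simp
    \<comment> \<open>Large enough that \<open>2 * b + t * c\<close> is at most
      \<open>- \<bar>a\<bar> - 1\<close>, while \<open>t \<ge> 1\<close>.\<close>
    define t where "t = (\<bar>a\<bar> + 2 * \<bar>b\<bar> + 1) / (- c) + 1"
    have t1: "t \<ge> 1" using c unfolding t_def by (simp add: divide_nonneg_neg)
    have tc: "t * c = - (\<bar>a\<bar> + 2 * \<bar>b\<bar> + 1) + c" using c unfolding t_def by (simp add: field_simps)
    have "a + 2 * t * b + t\<^sup>2 * c = a + t * (2 * b + t * c)"
      by (simp add: power2_eq_square algebra_simps)
    also have "\<dots> \<le> a + t * (- \<bar>a\<bar> - 1)"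
      unfolding tc using t1 c by (intro add_left_mono mult_left_mono) auto
    also have "\<dots> \<le> a + 1 * (- \<bar>a\<bar> - 1)"
      using t1 by (intro add_left_mono mult_right_mono_neg) auto
    also have "\<dots> < 0" by auto
    finally show False using assms[of t] by linarith
  qed
  with assms[of "- b / c"] show ?thesis by (simp add: field_simps power2_eq_square)
qed

section \<open>Products and limits in L^2\<close>

lemma integrable_mult_sq:
  fixes f g :: "'a \<Rightarrow> real"
  assumes [measurable]: "f \<in> borel_measurable M" "g \<in> borel_measurable M"
    and "integrable M (\<lambda>x. (f x)\<^sup>2)" "integrable M (\<lambda>x. (g x)\<^sup>2)"
  shows "integrable M (\<lambda>x. f x * g x)"
proof (rule Bochner_Integration.integrable_bound)
  show "integrable M (\<lambda>x. (f x)\<^sup>2 + (g x)\<^sup>2)" using assms by simp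
  show "AE x in M. norm (f x * g x) \<le> norm ((f x)\<^sup>2 + (g x)\<^sup>2)"
  proof (rule AE_I2)
    fix x
    have "2 * (\<bar>f x\<bar> * \<bar>g x\<bar>) \<le> (f x)\<^sup>2 + (g x)\<^sup>2"
      using sum_squares_bound[of "\<bar>f x\<bar>" "\<bar>g x\<bar>"] by (simp add: mult.assoc)
    moreover have "0 \<le> \<bar>f x\<bar> * \<bar>g x\<bar>" by simp
    ultimately show "norm (f x * g x) \<le> norm ((f x)\<^sup>2 + (g x)\<^sup>2)"
      unfolding real_norm_def abs_mult by linarith
  qed
qed simp

lemma integrable_sq_add:
  fixes f g :: "'a \<Rightarrow> real"
  assumes [measurable]: "f \<in> borel_measurable M" "g \<in> borel_measurable M"
    and "integrable M (\<lambda>x. (f x)\<^sup>2)" "integrable M (\<lambda>x. (g x)\<^sup>2)"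
  shows "integrable M (\<lambda>x. (f x + g x)\<^sup>2)"
  using assms integrable_mult_sq[OF assms] by (simp add: power2_sum mult.assoc)

text \<open>A subsequence \<open>r\<close> whose increments have squared \<open>L\<^sup>2\<close> norm at most \<open>8\<^sup>-\<^sup>j\<close> makes
  \<open>\<Sum>j. 4^j (u (r (j+1)) - u (r j))\<^sup>2\<close> integrable, so the increments are a.e. \<open>O(2\<^sup>-\<^sup>j)\<close>.\<close>

lemma L2_Cauchy_AE_subseq:
  fixes u :: "nat \<Rightarrow> 'a \<Rightarrow> real"
  assumes [measurable]: "\<And>k. u k \<in> borel_measurable M"
    and Cauchy: "\<And>k m. k \<le> m \<Longrightarrow> (\<integral>\<^sup>+ x. ennreal ((u k x - u m x)\<^sup>2) \<partial>M) \<le> ennreal (e k)"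
    and e: "e \<longlonglongrightarrow> 0"
  obtains r v where "strict_mono (r :: nat \<Rightarrow> nat)" "v \<in> borel_measurable M"
    "AE x in M. (\<lambda>j. u (r j) x) \<longlonglongrightarrow> v x"
proof -
  have "\<exists>r. \<forall>j. e (r j) \<le> (1/8)^j \<and> r j < r (Suc j)"
  proof (rule dependent_nat_choice)
    have *: "\<exists>N. \<forall>n\<ge>N. e n \<le> (1/8)^j" for j
    proof -
      have "eventually (\<lambda>n. e n < (1/8)^j) sequentially"
        using e by (intro order_tendstoD) auto
      then show ?thesis unfolding eventually_sequentially by (meson less_imp_le)
    qed
    show "\<exists>x. e x \<le> (1/8)^0" using *[of 0] by auto
    fix x j
    obtain N where "\<forall>n\<ge>N. e n \<le> (1/8)^(Suc j)" using *[of "Suc j"] by auto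
    then show "\<exists>y. e y \<le> (1/8)^Suc j \<and> x < y"
      by (intro exI[of _ "max N (Suc x)"]) auto
  qed
  then obtain r where er: "\<And>j. e (r j) \<le> (1/8)^j" and "\<And>j. r j < r (Suc j)" by auto
  then have r: "strict_mono r" by (simp add: strict_mono_Suc_iff)
  define d where "d j x = u (r (Suc j)) x - u (r j) x" for j x
  have [measurable]: "d j \<in> borel_measurable M" for j unfolding d_def by measurable
  have dj: "(\<integral>\<^sup>+ x. ennreal (4^j * (d j x)\<^sup>2) \<partial>M) \<le> ennreal ((1/2)^j)" for j
  proof -
    have "(\<integral>\<^sup>+ x. ennreal (4^j * (d j x)\<^sup>2) \<partial>M) = ennreal (4^j) * (\<integral>\<^sup>+ x. ennreal ((d j x)\<^sup>2) \<partial>M)"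
      by (subst nn_integral_cmult[symmetric]) (auto simp: ennreal_mult)
    also have "(\<integral>\<^sup>+ x. ennreal ((d j x)\<^sup>2) \<partial>M) \<le> ennreal (e (r j))"
      using Cauchy[of "r j" "r (Suc j)"] strict_mono_less_eq[OF r, of j "Suc j"]
      unfolding d_def by (simp add: power2_commute)
    also have "\<dots> \<le> ennreal ((1/8)^j)" using er by (rule ennreal_leI)
    finally have "(\<integral>\<^sup>+ x. ennreal (4^j * (d j x)\<^sup>2) \<partial>M) \<le> ennreal (4^j) * ennreal ((1/8)^j)"
      by (simp add: mult_left_mono)
    also have "\<dots> = ennreal ((1/2)^j)"
      by (simp add: ennreal_mult[symmetric] power_mult_distrib[symmetric])
    finally show ?thesis .
  qed
  have "(\<integral>\<^sup>+ x. (\<Sum>j. ennreal (4^j * (d j x)\<^sup>2)) \<partial>M) = (\<Sum>j. \<integral>\<^sup>+ x. ennreal (4^j * (d j x)\<^sup>2) \<partial>M)"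
    by (rule nn_integral_suminf) measurable
  also have "\<dots> \<le> (\<Sum>j. ennreal ((1/2)^j))"
    using dj by (intro suminf_le) auto
  also have "\<dots> < \<infinity>"
    by (subst suminf_ennreal2) (auto simp: summable_geometric)
  finally have "AE x in M. (\<Sum>j. ennreal (4^j * (d j x)\<^sup>2)) \<noteq> \<infinity>"
    by (intro nn_integral_noteq_infinite) auto
  then have conv: "AE x in M. convergent (\<lambda>j. u (r j) x)"
  proof eventually_elim
    fix x assume fin: "(\<Sum>j. ennreal (4^j * (d j x)\<^sup>2)) \<noteq> \<infinity>"
    have sm: "summable (\<lambda>j. 4^j * (d j x)\<^sup>2)"
      using fin by (intro summable_suminf_not_top) auto
    define C where "C = (\<Sum>j. 4^j * (d j x)\<^sup>2)"
    have C: "4^j * (d j x)\<^sup>2 \<le> C" for j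
      using sum_le_suminf[OF sm, of "{j}"] unfolding C_def by auto
    have "\<bar>d j x\<bar> \<le> sqrt C * (1/2)^j" for j
    proof -
      have "(2^j * \<bar>d j x\<bar>)\<^sup>2 \<le> C"
      proof -
        have "((2::real)^j)\<^sup>2 = 4^j" by (simp add: power2_eq_square power_mult_distrib[symmetric])
        then show ?thesis using C[of j] by (simp only: power_mult_distrib power2_abs)
      qed
      then have "2^j * \<bar>d j x\<bar> \<le> sqrt C" by (rule real_le_rsqrt)
      then show ?thesis by (simp add: field_simps power_one_over)
    qed
    then have "summable (\<lambda>j. d j x)"
      using summable_mult[OF summable_geometric[of "1/2 :: real"], of "sqrt C"]
      by - (rule summable_comparison_test'[of "\<lambda>j. sqrt C * (1/2)^j" 0], simp_all)
    then have "convergent (\<lambda>n. \<Sum>j<n. d j x)" by (simp add: summable_iff_convergent)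
    then have "convergent (\<lambda>n. u (r 0) x + (\<Sum>j<n. d j x))"
      by (intro convergent_add convergent_const)
    moreover have "u (r 0) x + (\<Sum>j<n. d j x) = u (r n) x" for n
      unfolding d_def by (subst sum_lessThan_telescope[of "\<lambda>j. u (r j) x"]) simp
    ultimately show "convergent (\<lambda>j. u (r j) x)" by simp
  qed
  show thesis
  proof
    show "strict_mono r" by fact
    show "(\<lambda>x. lim (\<lambda>j. u (r j) x)) \<in> borel_measurable M" by measurable
    show "AE x in M. (\<lambda>j. u (r j) x) \<longlonglongrightarrow> lim (\<lambda>j. u (r j) x)"
      using conv by eventually_elim (simp add: convergent_LIMSEQ_iff)
  qed
qed

text \<open>Fatou's lemma. The bound is asked only eventually because a Cauchy estimate between
  \<open>u k\<close> and \<open>u (r j)\<close> is available only once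
  \<open>k \<le> r j\<close>.\<close>

lemma nn_integral_le_AE_limit:
  fixes g :: "nat \<Rightarrow> 'a \<Rightarrow> real"
  assumes [measurable]: "\<And>j. g j \<in> borel_measurable M"
    and lim: "AE x in M. (\<lambda>j. g j x) \<longlonglongrightarrow> h x"
    and le: "eventually (\<lambda>j. (\<integral>\<^sup>+ x. ennreal (g j x) \<partial>M) \<le> C) sequentially"
  shows "(\<integral>\<^sup>+ x. ennreal (h x) \<partial>M) \<le> C"
proof -
  have "AE x in M. ennreal (h x) = liminf (\<lambda>j. ennreal (g j x))"
    using lim by eventually_elim (rule lim_imp_Liminf[symmetric, OF sequentially_bot], rule tendsto_ennrealI)
  then have "(\<integral>\<^sup>+ x. ennreal (h x) \<partial>M) = (\<integral>\<^sup>+ x. liminf (\<lambda>j. ennreal (g j x)) \<partial>M)"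
    by (rule nn_integral_cong_AE)
  also have "\<dots> \<le> liminf (\<lambda>j. \<integral>\<^sup>+ x. ennreal (g j x) \<partial>M)"
    by (rule nn_integral_liminf) measurable
  also have "\<dots> \<le> C"
    using le by (intro Liminf_le) auto
  finally show ?thesis .
qed

section \<open>The Gagliardo form\<close>

text \<open>The exponent is half that of the kernel, so the Gagliardo form is the L^2 inner product
  of these quotients on the product space, and bilinearity, Cauchy-Schwarz and Fatou are inherited
  from L^2. On the diagonal the value is 0/0 = 0.\<close>

definition dquot :: "real \<Rightarrow> ('a::euclidean_space \<Rightarrow> real) \<Rightarrow> 'a \<times> 'a \<Rightarrow> real"
  where "dquot s u z = (u (fst z) - u (snd z)) / norm (fst z - snd z) powr ((real DIM('a) + 2 * s) / 2)"

lemma dquot_mult: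
  fixes u v :: "'a::euclidean_space \<Rightarrow> real"
  shows "dquot s u z * dquot s v z
    = (u (fst z) - u (snd z)) * (v (fst z) - v (snd z)) / norm (fst z - snd z) powr (real DIM('a) + 2 * s)"
  unfolding dquot_def by (simp add: powr_add[symmetric])

lemma dquot_sq:
  fixes u :: "'a::euclidean_space \<Rightarrow> real"
  shows "(dquot s u z)\<^sup>2 = (u (fst z) - u (snd z))\<^sup>2 / norm (fst z - snd z) powr (real DIM('a) + 2 * s)"
  unfolding power2_eq_square by (rule dquot_mult)

lemma dquot_lincomb: "dquot s (\<lambda>x. a * u x + b * v x) z = a * dquot s u z + b * dquot s v z"
  unfolding dquot_def by (simp add: add_divide_distrib[symmetric] algebra_simps)

lemma dquot_diff: "dquot s (\<lambda>x. u x - v x) z = dquot s u z - dquot s v z"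
  using dquot_lincomb[of s 1 u "- 1" v z] by simp

lemma gagliardo_sq_dquot:
  "gagliardo_sq s u = (\<integral>\<^sup>+ z. ennreal ((dquot s u z)\<^sup>2) \<partial>lebesgue)"
  unfolding gagliardo_sq_def dquot_sq by (simp add: case_prod_unfold)

lemma gagliardo_form_dquot:
  "gagliardo_form s u v = (\<integral> z. dquot s u z * dquot s v z \<partial>lebesgue)"
  unfolding gagliardo_form_def dquot_mult by (simp add: case_prod_unfold)

lemma borel_measurable_dquot:
  fixes u :: "'a::euclidean_space \<Rightarrow> real"
  assumes "u \<in> borel_measurable lebesgue"
  shows "dquot s u \<in> borel_measurable lebesgue"
proof -
  have [measurable]: "(\<lambda>z::'a \<times> 'a. norm (fst z - snd z)) \<in> borel_measurable lebesgue"
    by (intro measurable_completion) (simp add: lborel_prod[symmetric])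
  note [measurable] = borel_measurable_lebesgue_fst[OF assms] borel_measurable_lebesgue_snd[OF assms]
  show ?thesis unfolding dquot_def by measurable
qed

lemma Hs_iff: "u \<in> Hs s \<longleftrightarrow> u \<in> borel_measurable lebesgue \<and> integrable lebesgue (\<lambda>x. (u x)\<^sup>2)
    \<and> integrable lebesgue (\<lambda>z. (dquot s u z)\<^sup>2)"
proof -
  have "u \<in> borel_measurable lebesgue \<Longrightarrow>
      gagliardo_sq s u < \<infinity> \<longleftrightarrow> integrable lebesgue (\<lambda>z. (dquot s u z)\<^sup>2)"
    using borel_measurable_dquot[of u s]
    unfolding gagliardo_sq_dquot integrable_iff_bounded by simp
  then show ?thesis unfolding Hs_def by auto
qed

lemma gagliardo_sq_eq_form:
  assumes "u \<in> Hs s"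
  shows "gagliardo_sq s u = ennreal (gagliardo_form s u u)"
  using assms unfolding gagliardo_sq_dquot gagliardo_form_dquot Hs_iff
  by (simp add: nn_integral_eq_integral power2_eq_square[symmetric])

lemma gagliardo_form_self_nonneg: "0 \<le> gagliardo_form s u u"
  unfolding gagliardo_form_dquot by simp

lemma gagliardo_form_commute: "gagliardo_form s u v = gagliardo_form s v u"
  unfolding gagliardo_form_dquot by (simp add: mult.commute)

lemma integrable_dquot_mult:
  assumes "u \<in> Hs s" "v \<in> Hs s"
  shows "integrable lebesgue (\<lambda>z. dquot s u z * dquot s v z)"
  using assms unfolding Hs_iff by (intro integrable_mult_sq borel_measurable_dquot) auto

lemma Hs_lincomb:
  assumes "u \<in> Hs s" "v \<in> Hs s"
  shows "(\<lambda>x. a * u x + b * v x) \<in> Hs s"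
proof -
  note [measurable] = borel_measurable_dquot
  have [measurable]: "u \<in> borel_measurable lebesgue" "v \<in> borel_measurable lebesgue"
    using assms by (auto simp: Hs_iff)
  have "integrable lebesgue (\<lambda>x. (a * u x + b * v x)\<^sup>2)"
    using assms by (intro integrable_sq_add) (auto simp: Hs_iff power_mult_distrib)
  moreover have "integrable lebesgue (\<lambda>z. (a * dquot s u z + b * dquot s v z)\<^sup>2)"
    using assms by (intro integrable_sq_add) (auto simp: Hs_iff power_mult_distrib)
  ultimately show ?thesis by (simp add: Hs_iff dquot_lincomb)
qed

lemma gagliardo_form_lincomb:
  assumes "u \<in> Hs s" "v \<in> Hs s" "w \<in> Hs s"
  shows "gagliardo_form s (\<lambda>x. a * u x + b * v x) w = a * gagliardo_form s u w + b * gagliardo_form s v w"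
  using integrable_dquot_mult[OF assms(1,3)] integrable_dquot_mult[OF assms(2,3)]
  unfolding gagliardo_form_dquot dquot_lincomb
  by (simp add: distrib_right mult.assoc)

lemma Hs0_lincomb:
  assumes "u \<in> Hs0 s D" "v \<in> Hs0 s D"
  shows "(\<lambda>x. a * u x + b * v x) \<in> Hs0 s D"
proof -
  have "AE x in lebesgue. x \<notin> D \<longrightarrow> u x = 0" "AE x in lebesgue. x \<notin> D \<longrightarrow> v x = 0"
    using assms by (auto simp: Hs0_def)
  then have "AE x in lebesgue. x \<notin> D \<longrightarrow> a * u x + b * v x = 0"
    by eventually_elim auto
  then show ?thesis using assms Hs_lincomb[of u s v a b] by (auto simp: Hs0_def)
qed

lemma Hs0_diff: "u \<in> Hs0 s D \<Longrightarrow> v \<in> Hs0 s D \<Longrightarrow> (\<lambda>x. u x - v x) \<in> Hs0 s D"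
  using Hs0_lincomb[of u s D v 1 "-1"] by simp

lemma Hs0_imp_Hs: "u \<in> Hs0 s D \<Longrightarrow> u \<in> Hs s"
  by (simp add: Hs0_def)

lemma gagliardo_form_self_lincomb:
  assumes "u \<in> Hs s" "v \<in> Hs s"
  shows "gagliardo_form s (\<lambda>x. a * u x + b * v x) (\<lambda>x. a * u x + b * v x)
    = a\<^sup>2 * gagliardo_form s u u + 2 * a * b * gagliardo_form s u v + b\<^sup>2 * gagliardo_form s v v"
proof -
  let ?w = "\<lambda>x. a * u x + b * v x"
  have "gagliardo_form s u ?w = a * gagliardo_form s u u + b * gagliardo_form s u v"
    unfolding gagliardo_form_commute[of s u ?w] gagliardo_form_commute[of s u v]
    by (rule gagliardo_form_lincomb[OF assms assms(1)])
  moreover have "gagliardo_form s v ?w = a * gagliardo_form s u v + b * gagliardo_form s v v"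
    unfolding gagliardo_form_commute[of s v ?w]
    by (rule gagliardo_form_lincomb[OF assms assms(2)])
  ultimately show ?thesis
    using assms by (simp add: gagliardo_form_lincomb Hs_lincomb power2_eq_square algebra_simps)
qed

lemma gagliardo_form_diff_left:
  assumes "u \<in> Hs s" "v \<in> Hs s" "w \<in> Hs s"
  shows "gagliardo_form s (\<lambda>x. u x - v x) w = gagliardo_form s u w - gagliardo_form s v w"
  using gagliardo_form_lincomb[OF assms, of 1 "-1"] by simp

lemma gagliardo_form_Cauchy_Schwarz:
  assumes "u \<in> Hs s" "v \<in> Hs s"
  shows "(gagliardo_form s u v)\<^sup>2 \<le> gagliardo_form s u u * gagliardo_form s v v"
proof (rule real_quadratic_nonneg_bound)
  fix t
  show "0 \<le> gagliardo_form s u u + 2 * t * gagliardo_form s u v + t\<^sup>2 * gagliardo_form s v v"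
    using gagliardo_form_self_lincomb[OF assms, of 1 t]
      gagliardo_form_self_nonneg[of s "\<lambda>x. 1 * u x + t * v x"] by simp
qed

lemma integral_mult_sq_le:
  fixes f g :: "'a \<Rightarrow> real"
  assumes [measurable]: "f \<in> borel_measurable M" "g \<in> borel_measurable M"
    and "integrable M (\<lambda>x. (f x)\<^sup>2)" "integrable M (\<lambda>x. (g x)\<^sup>2)"
  shows "(\<integral>x. f x * g x \<partial>M)\<^sup>2 \<le> (\<integral>x. (f x)\<^sup>2 \<partial>M) * (\<integral>x. (g x)\<^sup>2 \<partial>M)"
proof (rule real_quadratic_nonneg_bound)
  fix t
  have "0 \<le> (\<integral>x. (f x + t * g x)\<^sup>2 \<partial>M)" by simp
  also have "\<dots> = (\<integral>x. (f x)\<^sup>2 + (2 * t * (f x * g x) + t\<^sup>2 * (g x)\<^sup>2) \<partial>M)"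
    by (rule Bochner_Integration.integral_cong) (auto simp: power2_eq_square algebra_simps)
  also have "\<dots> = (\<integral>x. (f x)\<^sup>2 \<partial>M) + 2 * t * (\<integral>x. f x * g x \<partial>M) + t\<^sup>2 * (\<integral>x. (g x)\<^sup>2 \<partial>M)"
    using assms integrable_mult_sq[OF assms] by simp
  finally show "0 \<le> (\<integral>x. (f x)\<^sup>2 \<partial>M) + 2 * t * (\<integral>x. f x * g x \<partial>M) + t\<^sup>2 * (\<integral>x. (g x)\<^sup>2 \<partial>M)" .
qed

text \<open>A normal contraction decreases the L^2 norm and every difference quotient and keeps the
  zero exterior values. This is what makes truncations of a solution admissible as test
  functions.\<close>

lemma Hs0_contraction:
  assumes u: "u \<in> Hs0 s D" and [measurable]: "v \<in> borel_measurable lebesgue"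
    and le: "AE x in lebesgue. \<bar>v x\<bar> \<le> \<bar>u x\<bar>" and le2: "\<And>x y. \<bar>v x - v y\<bar> \<le> \<bar>u x - u y\<bar>"
  shows "v \<in> Hs0 s D"
proof -
  have "integrable lebesgue (\<lambda>x. (v x)\<^sup>2)"
  proof (rule Bochner_Integration.integrable_bound)
    show "integrable lebesgue (\<lambda>x. (u x)\<^sup>2)" using u by (simp add: Hs0_def Hs_iff)
    show "AE x in lebesgue. norm ((v x)\<^sup>2) \<le> norm ((u x)\<^sup>2)"
      using le by eventually_elim (simp add: abs_le_square_iff)
  qed simp
  moreover have "integrable lebesgue (\<lambda>z. (dquot s v z)\<^sup>2)"
  proof (rule Bochner_Integration.integrable_bound)
    show "integrable lebesgue (\<lambda>z. (dquot s u z)\<^sup>2)" using u by (simp add: Hs0_def Hs_iff)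
    have "(v x - v y)\<^sup>2 \<le> (u x - u y)\<^sup>2" for x y
      using le2 by (simp add: abs_le_square_iff)
    then show "AE z in lebesgue. norm ((dquot s v z)\<^sup>2) \<le> norm ((dquot s u z)\<^sup>2)"
      by (intro AE_I2) (simp add: dquot_sq divide_right_mono)
    show "(\<lambda>z. (dquot s v z)\<^sup>2) \<in> borel_measurable lebesgue"
      using borel_measurable_dquot[of v s] by simp
  qed
  moreover have "AE x in lebesgue. x \<notin> D \<longrightarrow> v x = 0"
  proof -
    have "AE x in lebesgue. x \<notin> D \<longrightarrow> u x = 0" using u by (simp add: Hs0_def)
    then show ?thesis using le by eventually_elim auto
  qed
  ultimately show ?thesis by (simp add: Hs0_def Hs_iff)
qed

section \<open>Poincare inequality and completeness of \<open>Hs0 s D\<close>\<close>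

locale bounded_open_set =
  fixes D :: "'a::euclidean_space set" and s :: real
  assumes s_pos: "0 < s" and s_less_1: "s < 1" and open_D: "open D" and bounded_D: "bounded D"
begin

abbreviation kernel :: "'a \<Rightarrow> 'a \<Rightarrow> real"
  where "kernel x y \<equiv> 1 / norm (x - y) powr (real DIM('a) + 2 * s)"

lemma D_sets [measurable]: "D \<in> sets lebesgue" "D \<in> sets borel"
  using open_D by auto

lemma emeasure_D_finite: "emeasure lebesgue D < \<infinity>"
  using emeasure_bounded_finite[OF bounded_D] open_D by simp

lemma finite_measure_D: "finite_measure (lebesgue_on D)"
  using emeasure_D_finite D_sets by (intro finite_measureI) (simp add: emeasure_restrict_space)

text \<open>Boundedness of D keeps all distances between D and the ball bounded, and the kernel
  decreases with distance. The unit ball around a point of norm R + 1 consists of points of norm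
  between R and R + 2, hence misses D and stays within 2R + 2 of it.\<close>

lemma ball_off_D:
  obtains A :: "'a set" and \<kappa> where "A \<in> sets borel" "emeasure lebesgue A = ennreal (measure lebesgue A)"
    "0 < measure lebesgue A" "0 < \<kappa>" "A \<inter> D = {}" "\<And>x y. x \<in> D \<Longrightarrow> y \<in> A \<Longrightarrow> \<kappa> \<le> kernel x y"
proof -
  obtain R where R: "0 < R" "\<And>x. x \<in> D \<Longrightarrow> norm x \<le> R"
    using bounded_D bounded_pos by blast
  obtain b :: 'a where b: "b \<in> Basis" using nonempty_Basis by blast
  define z where "z = (R + 1) *\<^sub>R b"
  have nz: "norm z = R + 1" using b R(1) by (simp add: z_def)
  let ?p = "real DIM('a) + 2 * s"
  show thesis
  proof (rule that)
    show "ball z 1 \<in> sets borel" by simp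
    show "emeasure lebesgue (ball z 1) = ennreal (measure lebesgue (ball z 1))"
      using emeasure_lborel_ball_finite[of z 1] by (intro emeasure_eq_ennreal_measure) auto
    show "0 < measure lebesgue (ball z 1)"
      by (simp add: content_ball_pos)
    show "0 < 1 / (2 * R + 2) powr ?p" using R(1) by simp
    have far: "R < norm y" if "y \<in> ball z 1" for y
      using that norm_triangle_ineq[of "z - y" y] nz by (simp add: dist_norm)
    show "ball z 1 \<inter> D = {}" using far R(2) by fastforce
    fix x y assume x: "x \<in> D" and y: "y \<in> ball z 1"
    \<comment> \<open>On the diagonal \<open>kernel\<close> is 1/0 = 0, so the lower bound would
      fail there.\<close>
    have "x \<noteq> y" using far[OF y] R(2)[OF x] by auto
    moreover have "norm (x - y) \<le> 2 * R + 2"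
      using norm_triangle_ineq4[of x y] R(2)[OF x] y norm_triangle_ineq[of z "y - z"] nz
      by (simp add: dist_norm norm_minus_commute)
    ultimately show "1 / (2 * R + 2) powr ?p \<le> kernel x y"
      using s_pos R(1) by (intro divide_left_mono powr_mono2 mult_pos_pos) auto
  qed
qed

text \<open>Only the part \<open>D \<times> A\<close> of the double integral is kept: there v(y) = 0
  and the kernel is at least \<open>\<kappa>\<close>, so the integrand dominates
  \<open>\<kappa> * (v x)\<^sup>2\<close>, and integrating over y in \<open>A\<close> gives the
  factor \<open>m\<close>.\<close>

lemma Poincare:
  obtains C where "0 < C" "\<And>v. v \<in> Hs0 s D \<Longrightarrow> (\<integral>x. (v x)\<^sup>2 \<partial>lebesgue) \<le> C * gagliardo_form s v v"
proof -
  obtain A \<kappa> where A: "A \<in> sets borel" "emeasure lebesgue A = ennreal (measure lebesgue A)"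
    "0 < measure lebesgue A" "0 < \<kappa>" "A \<inter> D = {}" "\<And>x y. x \<in> D \<Longrightarrow> y \<in> A \<Longrightarrow> \<kappa> \<le> kernel x y"
    using ball_off_D by blast
  define m where "m = measure lebesgue A"
  have "(\<integral>x. (v x)\<^sup>2 \<partial>lebesgue) \<le> 1 / (\<kappa> * m) * gagliardo_form s v v" if v: "v \<in> Hs0 s D" for v
  proof -
    have v': "v \<in> Hs s" and [measurable]: "v \<in> borel_measurable lebesgue"
      and i: "integrable lebesgue (\<lambda>x. (v x)\<^sup>2)"
      using v by (auto simp: Hs0_def Hs_iff)
    have z: "AE x in lebesgue. x \<notin> D \<longrightarrow> v x = 0" using v by (simp add: Hs0_def)
    have "ennreal (\<kappa> * (\<integral>x. (v x)\<^sup>2 \<partial>lebesgue)) * ennreal m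
        = (\<integral>\<^sup>+ x. ennreal (\<kappa> * (v x)\<^sup>2) \<partial>lebesgue) * emeasure lebesgue A"
      using A i by (subst nn_integral_eq_integral) (auto simp: m_def)
    also have "\<dots> = (\<integral>\<^sup>+ z. ennreal (\<kappa> * (v (fst z))\<^sup>2) * indicator A (snd z) \<partial>lebesgue)"
      using A(1) by (subst nn_integral_lebesgue_Times_indicator) auto
    also have "\<dots> \<le> (\<integral>\<^sup>+ z. ennreal ((dquot s v z)\<^sup>2) \<partial>lebesgue)"
    proof (rule nn_integral_mono_AE)
      show "AE z in lebesgue. ennreal (\<kappa> * (v (fst z))\<^sup>2) * indicator A (snd z) \<le> ennreal ((dquot s v z)\<^sup>2)"
        using AE_lebesgue_fst[OF z] AE_lebesgue_snd[OF z]
      proof eventually_elim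
        case (elim z)
        show ?case
        proof (cases "fst z \<in> D \<and> snd z \<in> A")
          case True
          then have "v (snd z) = 0" using elim A(5) by auto
          then have "(dquot s v z)\<^sup>2 = kernel (fst z) (snd z) * (v (fst z))\<^sup>2" by (simp add: dquot_sq)
          moreover have "\<kappa> * (v (fst z))\<^sup>2 \<le> kernel (fst z) (snd z) * (v (fst z))\<^sup>2"
            using True A(6) by (intro mult_right_mono) auto
          ultimately show ?thesis using True by (simp add: ennreal_leI)
        next
          case False
          then show ?thesis using elim by (auto simp: indicator_def)
        qed
      qed
    qed
    also have "\<dots> = ennreal (gagliardo_form s v v)"
      using gagliardo_sq_eq_form[OF v'] by (simp add: gagliardo_sq_dquot)
    finally have "\<kappa> * (\<integral>x. (v x)\<^sup>2 \<partial>lebesgue) * m \<le> gagliardo_form s v v"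
      using A by (simp add: ennreal_mult[symmetric] m_def gagliardo_form_self_nonneg)
    then show ?thesis using A by (simp add: m_def field_simps)
  qed
  then show thesis using A by (intro that[of "1 / (\<kappa> * m)"]) (auto simp: m_def)
qed

text \<open>By Poincare a Cauchy sequence for the form is Cauchy in L^2, so a subsequence converges
  a.e. Its difference quotients then converge a.e. on the product, and Fatou carries the Cauchy
  bounds to the limit for every \<open>k\<close>, since only the second index runs along the
  subsequence.\<close>

lemma Hs0_complete:
  assumes u: "\<And>k. u k \<in> Hs0 s D"
    and Cauchy: "\<And>k m. k \<le> m \<Longrightarrow> gagliardo_form s (\<lambda>x. u k x - u m x) (\<lambda>x. u k x - u m x) \<le> e k"
    and e: "e \<longlonglongrightarrow> 0"
  obtains v where "v \<in> Hs0 s D"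
    "\<And>k. gagliardo_form s (\<lambda>x. u k x - v x) (\<lambda>x. u k x - v x) \<le> e k"
proof -
  obtain C where C: "0 < C" "\<And>v. v \<in> Hs0 s D \<Longrightarrow> (\<integral>x. (v x)\<^sup>2 \<partial>lebesgue) \<le> C * gagliardo_form s v v"
    using Poincare by blast
  have um: "\<And>k. u k \<in> borel_measurable lebesgue" using u by (auto simp: Hs0_def Hs_iff)
  note [measurable] = um
  have d: "(\<lambda>x. u k x - u m x) \<in> Hs0 s D" for k m using u by (intro Hs0_diff) auto
  have L2: "(\<integral>\<^sup>+ x. ennreal ((u k x - u m x)\<^sup>2) \<partial>lebesgue) \<le> ennreal (C * e k)" if "k \<le> m" for k m
  proof -
    have "(\<integral>\<^sup>+ x. ennreal ((u k x - u m x)\<^sup>2) \<partial>lebesgue) = ennreal (\<integral>x. (u k x - u m x)\<^sup>2 \<partial>lebesgue)"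
      using d[of k m] by (intro nn_integral_eq_integral) (auto simp: Hs0_def Hs_iff)
    also have "\<dots> \<le> ennreal (C * e k)"
      using order_trans[OF C(2)[OF d[of k m]] mult_left_mono[OF Cauchy[OF that], of C]] C(1)
      by (intro ennreal_leI) simp
    finally show ?thesis .
  qed
  have G: "(\<integral>\<^sup>+ z. ennreal ((dquot s (u k) z - dquot s (u m) z)\<^sup>2) \<partial>lebesgue) \<le> ennreal (e k)" if "k \<le> m" for k m
    using gagliardo_sq_eq_form[OF Hs0_imp_Hs[OF d[of k m]]] ennreal_leI[OF Cauchy[OF that]]
    by (simp add: gagliardo_sq_dquot dquot_diff)
  have Ce: "(\<lambda>k. C * e k) \<longlonglongrightarrow> 0" using tendsto_mult[OF tendsto_const e, of C] by simp
  obtain r v where r: "strict_mono (r :: nat \<Rightarrow> nat)" and v[measurable]: "v \<in> borel_measurable lebesgue"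
    and lim: "AE x in lebesgue. (\<lambda>j. u (r j) x) \<longlonglongrightarrow> v x"
    using L2_Cauchy_AE_subseq[OF um L2 Ce] by blast
  have ev: "eventually (\<lambda>j. k \<le> r j) sequentially" for k
    unfolding eventually_sequentially using seq_suble[OF r] by (meson order_trans)
  have Gv: "(\<integral>\<^sup>+ z. ennreal ((dquot s (\<lambda>x. u k x - v x) z)\<^sup>2) \<partial>lebesgue) \<le> ennreal (e k)" for k
  proof (rule nn_integral_le_AE_limit)
    show "(\<lambda>z. (dquot s (u k) z - dquot s (u (r j)) z)\<^sup>2) \<in> borel_measurable lebesgue" for j
      using borel_measurable_dquot[OF um[of k], of s] borel_measurable_dquot[OF um[of "r j"], of s] by simp
    show "AE z in lebesgue. (\<lambda>j. (dquot s (u k) z - dquot s (u (r j)) z)\<^sup>2)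
        \<longlonglongrightarrow> (dquot s (\<lambda>x. u k x - v x) z)\<^sup>2"
      using AE_lebesgue_fst[OF lim] AE_lebesgue_snd[OF lim]
    proof eventually_elim
      case (elim z)
      show ?case
        unfolding dquot_diff unfolding dquot_def divide_inverse using elim by (intro tendsto_intros)
    qed
    show "eventually (\<lambda>j. (\<integral>\<^sup>+ z. ennreal ((dquot s (u k) z - dquot s (u (r j)) z)\<^sup>2) \<partial>lebesgue) \<le> ennreal (e k)) sequentially"
      using ev[of k] by eventually_elim (rule G)
  qed
  have Lv: "(\<integral>\<^sup>+ x. ennreal ((u k x - v x)\<^sup>2) \<partial>lebesgue) \<le> ennreal (C * e k)" for k
  proof (rule nn_integral_le_AE_limit)
    show "(\<lambda>x. (u k x - u (r j) x)\<^sup>2) \<in> borel_measurable lebesgue" for j by measurable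
    show "AE x in lebesgue. (\<lambda>j. (u k x - u (r j) x)\<^sup>2) \<longlonglongrightarrow> (u k x - v x)\<^sup>2"
      using lim by eventually_elim (intro tendsto_intros)
    show "eventually (\<lambda>j. (\<integral>\<^sup>+ x. ennreal ((u k x - u (r j) x)\<^sup>2) \<partial>lebesgue) \<le> ennreal (C * e k)) sequentially"
      using ev[of k] by eventually_elim (rule L2)
  qed
  have dv: "(\<lambda>x. u k x - v x) \<in> Hs0 s D" for k
  proof -
    have "AE x in lebesgue. \<forall>j. x \<notin> D \<longrightarrow> u j x = 0"
      unfolding AE_all_countable using u by (auto simp: Hs0_def)
    then have "AE x in lebesgue. x \<notin> D \<longrightarrow> u k x - v x = 0"
      using lim
    proof eventually_elim
      case (elim x)
      show ?case
      proof
        assume "x \<notin> D"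
        with elim have "u j x = 0" for j by simp
        with elim(2) show "u k x - v x = 0" by (simp add: LIMSEQ_const_iff)
      qed
    qed
    moreover have "integrable lebesgue (\<lambda>x. (u k x - v x)\<^sup>2)"
      using le_less_trans[OF Lv[of k] ennreal_less_top] by (intro integrableI_bounded) simp_all
    moreover have "gagliardo_sq s (\<lambda>x. u k x - v x) < \<infinity>"
      using le_less_trans[OF Gv[of k] ennreal_less_top] by (simp add: gagliardo_sq_dquot)
    moreover have "(\<lambda>x. u k x - v x) \<in> borel_measurable lebesgue" by measurable
    ultimately show ?thesis by (simp add: Hs0_def Hs_def)
  qed
  show thesis
  proof
    \<comment> \<open>\<open>v\<close> is recovered as \<open>u 0 - (u 0 - v)\<close>.\<close>
    show "v \<in> Hs0 s D" using Hs0_diff[OF u[of 0] dv[of 0]] by simp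
    fix k
    have "0 \<le> e k" using order_trans[OF gagliardo_form_self_nonneg Cauchy[of k k]] by simp
    then show "gagliardo_form s (\<lambda>x. u k x - v x) (\<lambda>x. u k x - v x) \<le> e k"
      using Gv[of k] gagliardo_sq_eq_form[OF Hs0_imp_Hs[OF dv[of k]]]
      by (simp add: gagliardo_sq_dquot)
  qed
qed

end

section \<open>Weak solutions\<close>

lemma integral_lebesgue_on_eq:
  fixes f :: "'a::euclidean_space \<Rightarrow> real"
  assumes "D \<in> sets lebesgue"
  shows "(\<integral>x. f x \<partial>lebesgue_on D) = (\<integral>x. indicator D x * f x \<partial>lebesgue)"
  using assms by (subst integral_restrict_space) auto

lemma integrable_lebesgue_on_eq:
  fixes f :: "'a::euclidean_space \<Rightarrow> real"
  assumes "D \<in> sets lebesgue"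
  shows "integrable (lebesgue_on D) f \<longleftrightarrow> integrable lebesgue (\<lambda>x. indicator D x * f x)"
  using assms by (subst integrable_restrict_space) auto

lemma zero_in_Hs0: "(\<lambda>x. 0) \<in> Hs0 s D"
  by (simp add: Hs0_def Hs_iff dquot_def)

context bounded_open_set
begin

text \<open>L^2(D): the common class of sources and of restrictions of \<open>Hs0 s D\<close>, so
  that every pairing of the two is integrable.\<close>

definition sq_int :: "('a \<Rightarrow> real) \<Rightarrow> bool"
  where "sq_int f \<longleftrightarrow> f \<in> borel_measurable (lebesgue_on D) \<and> integrable (lebesgue_on D) (\<lambda>x. (f x)\<^sup>2)"

lemma sq_int_Hs0:
  assumes "v \<in> Hs0 s D"
  shows "sq_int v" "(\<integral>x. (v x)\<^sup>2 \<partial>lebesgue_on D) \<le> (\<integral>x. (v x)\<^sup>2 \<partial>lebesgue)"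
proof -
  have [measurable]: "v \<in> borel_measurable lebesgue" and i: "integrable lebesgue (\<lambda>x. (v x)\<^sup>2)"
    using assms by (auto simp: Hs0_def Hs_iff)
  have i': "integrable lebesgue (\<lambda>x. indicator D x * (v x)\<^sup>2)"
    by (rule Bochner_Integration.integrable_bound[OF i]) (auto simp: indicator_def)
  then show "sq_int v"
    by (auto simp: sq_int_def integrable_lebesgue_on_eq intro!: measurable_restrict_space1)
  show "(\<integral>x. (v x)\<^sup>2 \<partial>lebesgue_on D) \<le> (\<integral>x. (v x)\<^sup>2 \<partial>lebesgue)"
    unfolding integral_lebesgue_on_eq[OF D_sets(1)]
    by (rule integral_mono[OF i' i]) (auto simp: indicator_def)
qed

lemma sq_int_lincomb:
  assumes "sq_int f" "sq_int g"
  shows "sq_int (\<lambda>x. a * f x + b * g x)"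
proof -
  have [measurable]: "f \<in> borel_measurable (lebesgue_on D)" "g \<in> borel_measurable (lebesgue_on D)"
    using assms by (auto simp: sq_int_def)
  have "integrable (lebesgue_on D) (\<lambda>x. (a * f x + b * g x)\<^sup>2)"
    using assms by (intro integrable_sq_add) (auto simp: sq_int_def power_mult_distrib)
  then show ?thesis by (simp add: sq_int_def)
qed

lemma sq_int_bounded:
  assumes "f \<in> borel_measurable (lebesgue_on D)" "AE x in lebesgue_on D. \<bar>f x\<bar> \<le> C"
  shows "sq_int f"
proof -
  have "AE x in lebesgue_on D. norm ((f x)\<^sup>2) \<le> C\<^sup>2"
    using assms(2)
  proof eventually_elim
    case (elim x)
    show ?case using power_mono[OF elim, of 2] by simp
  qed
  from finite_measure.integrable_const_bound[OF finite_measure_D this]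
  show ?thesis using assms(1) by (simp add: sq_int_def)
qed

lemma sq_int_mult: "sq_int f \<Longrightarrow> sq_int g \<Longrightarrow> integrable (lebesgue_on D) (\<lambda>x. f x * g x)"
  unfolding sq_int_def by (intro integrable_mult_sq) auto

lemma sq_int_integrable: "sq_int f \<Longrightarrow> integrable (lebesgue_on D) f"
  using sq_int_mult[of f "\<lambda>x. 1"] sq_int_bounded[of "\<lambda>x. 1" 1] by simp

lemma sq_int_Hs0_bound:
  assumes "sq_int f"
  obtains K where "0 \<le> K" "\<And>v. v \<in> Hs0 s D \<Longrightarrow> (\<integral>x. f x * v x \<partial>lebesgue_on D)\<^sup>2 \<le> K * gagliardo_form s v v"
proof -
  obtain C where C: "0 < C" "\<And>v. v \<in> Hs0 s D \<Longrightarrow> (\<integral>x. (v x)\<^sup>2 \<partial>lebesgue) \<le> C * gagliardo_form s v v"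
    using Poincare by blast
  let ?F = "\<integral>x. (f x)\<^sup>2 \<partial>lebesgue_on D"
  have F: "0 \<le> ?F" by simp
  show thesis
  proof (rule that)
    show "0 \<le> ?F * C" using C(1) F by (intro mult_nonneg_nonneg) auto
    fix v assume v: "v \<in> Hs0 s D"
    have "(\<integral>x. f x * v x \<partial>lebesgue_on D)\<^sup>2 \<le> ?F * (\<integral>x. (v x)\<^sup>2 \<partial>lebesgue_on D)"
      using assms sq_int_Hs0(1)[OF v] unfolding sq_int_def by (intro integral_mult_sq_le) auto
    also have "\<dots> \<le> ?F * (C * gagliardo_form s v v)"
      using sq_int_Hs0(2)[OF v] C(2)[OF v] by (intro mult_left_mono F) auto
    finally show "(\<integral>x. f x * v x \<partial>lebesgue_on D)\<^sup>2 \<le> ?F * C * gagliardo_form s v v"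
      by (simp add: mult.assoc)
  qed
qed

lemma integral_mult_lincomb_right:
  assumes "sq_int f" "sq_int v" "sq_int w"
  shows "(\<integral>x. f x * (a * v x + b * w x) \<partial>lebesgue_on D)
    = a * (\<integral>x. f x * v x \<partial>lebesgue_on D) + b * (\<integral>x. f x * w x \<partial>lebesgue_on D)"
proof -
  have "(\<integral>x. f x * (a * v x + b * w x) \<partial>lebesgue_on D)
      = (\<integral>x. a * (f x * v x) + b * (f x * w x) \<partial>lebesgue_on D)"
    by (simp add: algebra_simps)
  also have "\<dots> = a * (\<integral>x. f x * v x \<partial>lebesgue_on D) + b * (\<integral>x. f x * w x \<partial>lebesgue_on D)"
    using assms sq_int_mult by simp
  finally show ?thesis .
qed

text \<open>Existence by the direct method: a minimizing sequence for
  \<open>J v = [v,v]/4 - \<integral>f v\<close> is Cauchy by the parallelogram law, and near-minimality of \<open>J (v\<^sub>k)\<close>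
  gives the Euler-Lagrange equation up to an error tending to 0.\<close>

lemma weak_solution_exists:
  assumes f: "sq_int f"
  shows "\<exists>u. weak_solution s D f u"
proof -
  let ?B = "gagliardo_form s"
  define F where "F v = (\<integral>x. f x * v x \<partial>lebesgue_on D)" for v
  \<comment> \<open>With the factor 1/4 the derivative in direction \<open>w\<close> is
    \<open>1/2 * ?B v w - F w\<close>, the residual of the weak equation.\<close>
  define J where "J v = ?B v v / 4 - F v" for v
  obtain K where K: "0 \<le> K" "\<And>v. v \<in> Hs0 s D \<Longrightarrow> (F v)\<^sup>2 \<le> K * ?B v v"
    using sq_int_Hs0_bound[OF f] unfolding F_def by blast
  have Flin: "F (\<lambda>x. a * v x + b * w x) = a * F v + b * F w" if "v \<in> Hs0 s D" "w \<in> Hs0 s D" for a b v w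
    unfolding F_def by (intro integral_mult_lincomb_right f sq_int_Hs0 that)
  have Jbd: "- K \<le> J v" if v: "v \<in> Hs0 s D" for v
  proof -
    have Q: "0 \<le> ?B v v" by (rule gagliardo_form_self_nonneg)
    have "(F v)\<^sup>2 \<le> (?B v v / 4 + K)\<^sup>2"
    proof -
      have "(?B v v / 4 + K)\<^sup>2 - K * ?B v v = (?B v v / 4 - K)\<^sup>2"
        by (simp add: power2_eq_square algebra_simps)
      then have "K * ?B v v \<le> (?B v v / 4 + K)\<^sup>2" by (metis diff_ge_0_iff_ge zero_le_power2)
      with K(2)[OF v] show ?thesis by linarith
    qed
    then have "\<bar>F v\<bar> \<le> ?B v v / 4 + K" using Q K(1) by (simp add: abs_le_square_iff[symmetric])
    then show ?thesis unfolding J_def by linarith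
  qed
  define m where "m = (INF v\<in>Hs0 s D. J v)"
  have bdd: "bdd_below (J ` Hs0 s D)" using Jbd by (intro bdd_belowI[of _ "-K"]) auto
  have m_le: "m \<le> J v" if "v \<in> Hs0 s D" for v
    unfolding m_def using bdd that by (rule cINF_lower)
  have "\<exists>v\<in>Hs0 s D. J v < m + 1 / real (Suc k)" for k
  proof -
    have "Inf (J ` Hs0 s D) < m + 1 / real (Suc k)" by (simp add: m_def)
    then show ?thesis
      using cInf_lessD[of "J ` Hs0 s D"] zero_in_Hs0[of s D] by blast
  qed
  then obtain v where v: "\<And>k. v k \<in> Hs0 s D" and Jv: "\<And>k. J (v k) < m + 1 / real (Suc k)"
    by metis
  \<comment> \<open>The form of \<open>v k - v l\<close>, divided by 16, is the mean of
    \<open>J (v k)\<close> and \<open>J (v l)\<close> minus \<open>J\<close> at the midpoint. This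
    is at most the mean of the two errors, and the error at \<open>k\<close> is the larger
    one.\<close>
  have Cauchy: "?B (\<lambda>x. v k x - v l x) (\<lambda>x. v k x - v l x) \<le> 16 / real (Suc k)" if "k \<le> l" for k l
  proof -
    have H: "v k \<in> Hs s" "v l \<in> Hs s" using v Hs0_imp_Hs by auto
    have "m \<le> J (\<lambda>x. 1/2 * v k x + 1/2 * v l x)" by (intro m_le Hs0_lincomb v)
    also have "\<dots> = (?B (v k) (v k) + 2 * ?B (v k) (v l) + ?B (v l) (v l)) / 16 - (F (v k) + F (v l)) / 2"
      unfolding J_def gagliardo_form_self_lincomb[OF H] Flin[OF v v] by (simp add: power2_eq_square field_simps)
    finally have "m \<le> (?B (v k) (v k) + 2 * ?B (v k) (v l) + ?B (v l) (v l)) / 16 - (F (v k) + F (v l)) / 2" .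
    moreover have "?B (\<lambda>x. v k x - v l x) (\<lambda>x. v k x - v l x)
        = ?B (v k) (v k) - 2 * ?B (v k) (v l) + ?B (v l) (v l)"
      using gagliardo_form_self_lincomb[OF H, of 1 "-1"] by simp
    moreover define p q where "p = 1 / real (Suc k)" and "q = 1 / real (Suc l)"
    moreover have "q \<le> p" using that by (simp add: frac_le p_def q_def)
    moreover have "J (v k) < m + p" "J (v l) < m + q" using Jv by (auto simp: p_def q_def)
    ultimately have "?B (\<lambda>x. v k x - v l x) (\<lambda>x. v k x - v l x) \<le> 16 * p"
      unfolding J_def by (simp add: field_simps)
    then show ?thesis by (simp add: p_def)
  qed
  have e: "(\<lambda>k. c / real (Suc k)) \<longlonglongrightarrow> 0" for c
    using tendsto_mult[OF tendsto_const LIMSEQ_inverse_real_of_nat, of c] by (simp add: divide_inverse)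
  obtain u where u: "u \<in> Hs0 s D"
    and lim: "\<And>k. ?B (\<lambda>x. v k x - u x) (\<lambda>x. v k x - u x) \<le> 16 / real (Suc k)"
    using Hs0_complete[OF v Cauchy e] by blast
  have "1/2 * ?B u w = F w" if w: "w \<in> Hs0 s D" for w
  proof -
    have Q: "0 \<le> ?B w w" by (rule gagliardo_form_self_nonneg)
    \<comment> \<open>The residual at \<open>v k\<close> contributes 2 to the factor 10, through the
      discriminant of a quadratic in \<open>t\<close>; replacing \<open>v k\<close> by
      \<open>u\<close> contributes 8, through Cauchy-Schwarz and \<open>lim\<close>.\<close>
    have "(1/2 * ?B u w - F w)\<^sup>2 \<le> (10 * ?B w w) / real (Suc k)" for k
    proof -
      have H: "v k \<in> Hs s" "w \<in> Hs s" "u \<in> Hs s" using u v w Hs0_imp_Hs by auto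
      have "((1/2 * ?B (v k) w - F w) / 2)\<^sup>2 \<le> 1 / real (Suc k) * (?B w w / 4)"
      proof (rule real_quadratic_nonneg_bound)
        fix t
        define p where "p = 1 / real (Suc k)"
        have "m \<le> J (\<lambda>x. 1 * v k x + t * w x)" by (intro m_le Hs0_lincomb v w)
        also have "\<dots> = (?B (v k) (v k) + 2 * t * ?B (v k) w + t\<^sup>2 * ?B w w) / 4 - (F (v k) + t * F w)"
          unfolding J_def gagliardo_form_self_lincomb[OF H(1,2)] Flin[OF v w] by simp
        finally have "m \<le> (?B (v k) (v k) + 2 * t * ?B (v k) w + t\<^sup>2 * ?B w w) / 4 - (F (v k) + t * F w)" .
        moreover have "?B (v k) (v k) / 4 - F (v k) < m + p" using Jv[of k] by (simp add: p_def J_def)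
        ultimately have "0 \<le> p + 2 * t * ((1/2 * ?B (v k) w - F w) / 2) + t\<^sup>2 * (?B w w / 4)"
          by (simp add: field_simps)
        then show "0 \<le> 1 / real (Suc k) + 2 * t * ((1/2 * ?B (v k) w - F w) / 2) + t\<^sup>2 * (?B w w / 4)"
          by (simp add: p_def)
      qed
      moreover have "(?B (v k) w - ?B u w)\<^sup>2 \<le> 16 / real (Suc k) * ?B w w"
      proof -
        have "(?B (\<lambda>x. v k x - u x) w)\<^sup>2 \<le> ?B (\<lambda>x. v k x - u x) (\<lambda>x. v k x - u x) * ?B w w"
          by (rule gagliardo_form_Cauchy_Schwarz[OF Hs0_imp_Hs[OF Hs0_diff[OF v u]] H(2)])
        also have "\<dots> \<le> 16 / real (Suc k) * ?B w w" by (intro mult_right_mono lim Q)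
        finally show ?thesis by (simp add: gagliardo_form_diff_left H)
      qed
      moreover have "(1/2 * ?B u w - F w)\<^sup>2 \<le> 8 * ((1/2 * ?B (v k) w - F w) / 2)\<^sup>2 + 1/2 * (?B (v k) w - ?B u w)\<^sup>2"
      proof -
        have "(p - q)\<^sup>2 \<le> 2 * p\<^sup>2 + 2 * q\<^sup>2" for p q :: real
          using sum_squares_bound[of p "- q"] by (simp add: power2_diff)
        from this[of "1/2 * ?B (v k) w - F w" "1/2 * (?B (v k) w - ?B u w)"]
        have "(1/2 * ?B (v k) w - F w - 1/2 * (?B (v k) w - ?B u w))\<^sup>2
            \<le> 8 * ((1/2 * ?B (v k) w - F w) / 2)\<^sup>2 + 1/2 * (?B (v k) w - ?B u w)\<^sup>2"
          by (simp add: power_divide power_mult_distrib)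
        moreover have "1/2 * ?B (v k) w - F w - 1/2 * (?B (v k) w - ?B u w) = 1/2 * ?B u w - F w"
          by (simp add: algebra_simps)
        ultimately show ?thesis by (simp only:)
      qed
      ultimately have "(1/2 * ?B u w - F w)\<^sup>2
          \<le> 8 * (1 / real (Suc k) * (?B w w / 4)) + 1/2 * (16 / real (Suc k) * ?B w w)" by linarith
      also have "8 * (1 / r * (q / 4)) + 1/2 * (16 / r * q) = (10 * q) / r" for r q :: real
        by (cases "r = 0") (auto simp: divide_simps)
      finally show ?thesis .
    qed
    then have "(1/2 * ?B u w - F w)\<^sup>2 \<le> 0"
      by (intro LIMSEQ_le_const[OF e]) auto
    then show ?thesis by simp
  qed
  then have "weak_solution s D f u" unfolding weak_solution_def F_def using u by auto
  then show ?thesis by blast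
qed

lemma weak_solution_solution: "sq_int f \<Longrightarrow> weak_solution s D f (solution s D f)"
  unfolding solution_def using weak_solution_exists by (rule someI_ex)

lemma weak_solutionD:
  assumes "weak_solution s D f u"
  shows "u \<in> Hs0 s D" "v \<in> Hs0 s D \<Longrightarrow> gagliardo_form s u v = 2 * (\<integral>x. f x * v x \<partial>lebesgue_on D)"
  using assms by (auto simp: weak_solution_def)

text \<open>Two weak solutions for the same source, tested with each other, have the same energy.
  Hence the choice made in \<open>solution\<close> does not affect \<open>Phi\<close>, and any weak
  solution, such as a linear combination of others, may be used to compute it.\<close>

lemma Phi_weak_solution:
  assumes f: "sq_int f" and u: "weak_solution s D f u"
  shows "Phi s D f = ennreal (gagliardo_form s u u)"
proof -
  let ?v = "solution s D f"
  have v: "weak_solution s D f ?v" by (rule weak_solution_solution[OF f])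
  have "gagliardo_form s ?v ?v = gagliardo_form s u ?v"
    using weak_solutionD[OF u] weak_solutionD[OF v] by simp
  also have "\<dots> = gagliardo_form s u u"
    unfolding gagliardo_form_commute[of s u ?v]
    using weak_solutionD[OF u] weak_solutionD[OF v] by simp
  finally show ?thesis
    using gagliardo_sq_eq_form[OF Hs0_imp_Hs[OF weak_solutionD(1)[OF v]]] by (simp add: Phi_def)
qed

lemma weak_solution_lincomb:
  assumes "sq_int f" "sq_int g" and u: "weak_solution s D f u" and v: "weak_solution s D g v"
  shows "weak_solution s D (\<lambda>x. a * f x + b * g x) (\<lambda>x. a * u x + b * v x)"
  unfolding weak_solution_def
proof (intro conjI ballI)
  note H = weak_solutionD(1)[OF u] weak_solutionD(1)[OF v]
  show "(\<lambda>x. a * u x + b * v x) \<in> Hs0 s D" by (intro Hs0_lincomb H)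
  fix w assume w: "w \<in> Hs0 s D"
  have "(\<integral>x. (a * f x + b * g x) * w x \<partial>lebesgue_on D)
      = a * (\<integral>x. f x * w x \<partial>lebesgue_on D) + b * (\<integral>x. g x * w x \<partial>lebesgue_on D)"
    using integral_mult_lincomb_right[OF sq_int_Hs0(1)[OF w] assms(1,2), of a b] by (simp add: mult.commute)
  then show "1 / 2 * gagliardo_form s (\<lambda>x. a * u x + b * v x) w = (\<integral>x. (a * f x + b * g x) * w x \<partial>lebesgue_on D)"
    using weak_solutionD(2)[OF u w] weak_solutionD(2)[OF v w] H w
    by (simp add: gagliardo_form_lincomb Hs0_imp_Hs)
qed

end

section \<open>Lipschitz test functions\<close>

lemma power_powr_eq: "0 < x \<Longrightarrow> (x ^ k) powr p = (x powr p) ^ k" for x p :: real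
  by (induction k) (simp_all add: powr_mult)

lemma emeasure_lborel_ball_0_scale:
  assumes "0 \<le> r"
  shows "emeasure lborel (ball (0::'a::euclidean_space) r) = ennreal (unit_ball_vol DIM('a) * r ^ DIM('a))"
  using emeasure_ball[of r "0::'a"] assms by simp

text \<open>Serves both the singularity and the tail of the kernel: weight times volume of the j-th
  ball is a geometric sequence, so the integrals of the layers sum.\<close>

lemma nn_integral_dyadic_finite:
  fixes r :: "nat \<Rightarrow> real"
  assumes "\<And>j. 0 \<le> c j" "\<And>j. 0 \<le> r j"
    and "\<And>j. c j * r j ^ DIM('a) = A * q ^ j" and "0 \<le> A" "0 \<le> q" "q < 1"
  shows "(\<integral>\<^sup>+ z. (\<Sum>j. ennreal (c j) * indicator (ball (0::'a::euclidean_space) (r j)) z) \<partial>lborel) < \<infinity>"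
proof -
  let ?V = "unit_ball_vol DIM('a)"
  have "(\<integral>\<^sup>+ z. (\<Sum>j. ennreal (c j) * indicator (ball (0::'a) (r j)) z) \<partial>lborel)
      = (\<Sum>j. \<integral>\<^sup>+ z. ennreal (c j) * indicator (ball (0::'a) (r j)) z \<partial>lborel)"
    by (rule nn_integral_suminf) (intro borel_measurable_times_ennreal borel_measurable_const borel_measurable_indicator, simp)
  also have "\<dots> = (\<Sum>j. ennreal (?V * A * q ^ j))"
  proof (rule suminf_cong)
    fix j
    have "(\<integral>\<^sup>+ z. ennreal (c j) * indicator (ball (0::'a) (r j)) z \<partial>lborel)
        = ennreal (c j) * ennreal (?V * r j ^ DIM('a))"
      using assms(2)[of j] by (subst nn_integral_cmult_indicator) (simp_all add: emeasure_lborel_ball_0_scale)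
    also have "\<dots> = ennreal (?V * (c j * r j ^ DIM('a)))"
      using assms(1,2) by (simp add: ennreal_mult[symmetric] mult.left_commute)
    finally show "(\<integral>\<^sup>+ z. ennreal (c j) * indicator (ball (0::'a) (r j)) z \<partial>lborel) = ennreal (?V * A * q ^ j)"
      by (simp add: assms(3) mult.assoc)
  qed
  also have "\<dots> < \<infinity>"
  proof -
    have "summable (\<lambda>j. ?V * A * q ^ j)"
      using assms by (intro summable_mult summable_geometric) simp
    then show ?thesis using assms by (subst suminf_ennreal2) auto
  qed
  finally show ?thesis .
qed

lemma le_suminf_indicator:
  assumes "z \<in> B j" "x \<le> c j"
  shows "ennreal x \<le> (\<Sum>j. ennreal (c j) * indicator (B j) z)"
proof -
  have "ennreal x \<le> (\<Sum>j\<in>{j}. ennreal (c j) * indicator (B j) z)"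
    using assms by (simp add: ennreal_leI)
  also have "\<dots> \<le> (\<Sum>j. ennreal (c j) * indicator (B j) z)"
    by (rule sum_le_suminf) auto
  finally show ?thesis .
qed

text \<open>Dyadic balls: radii \<open>2\<^sup>-\<^sup>j\<close> (singularity) give a geometric series of ratio
  \<open>2 powr (2 * s) / 4\<close>, radii \<open>2 ^ Suc j\<close> (tail) one of ratio \<open>1 / 2 powr (2 * s)\<close>.\<close>

lemma nn_integral_fractional_kernel_finite:
  assumes "0 < s" "s < 1"
  shows "(\<integral>\<^sup>+ z. ennreal (min ((norm z)\<^sup>2) 1 / norm z powr (real DIM('a) + 2 * s))
    \<partial>(lborel :: 'a::euclidean_space measure)) < \<infinity>"
proof -
  let ?p = "real DIM('a) + 2 * s"
  let ?k = "\<lambda>z::'a. min ((norm z)\<^sup>2) 1 / norm z powr ?p"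
  define P where "P = (2::real) powr ?p"
  have P: "0 < P" by (simp add: P_def)
  have Pn: "P = 2 ^ DIM('a) * 2 powr (2 * s)"
    by (simp add: P_def powr_add powr_realpow)
  have half: "((1/2)^j) powr ?p = (1 / P) ^ j" for j
    by (simp add: power_powr_eq P_def powr_divide)
  \<comment> \<open>For 2^-(j+1) <= |z| < 2^-j the numerator is at most 4^-j and the denominator at
    least P^-(j+1). For 2^j <= |z| < 2^(j+1) the numerator is 1 and the denominator at least P^j,
    which gives \<open>c2\<close>.\<close>
  define c1 where "c1 j = (1/4)^j * P ^ Suc j" for j
  define c2 where "c2 j = (1 / P) ^ j" for j
  let ?f1 = "\<lambda>z. \<Sum>j. ennreal (c1 j) * indicator (ball (0::'a) ((1/2)^j)) z"
  let ?f2 = "\<lambda>z. \<Sum>j. ennreal (c2 j) * indicator (ball (0::'a) (2^Suc j)) z"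
  have le: "ennreal (?k z) \<le> ?f1 z + ?f2 z" for z
  proof -
    consider "z = 0" | "0 < norm z" "norm z < 1" | "1 \<le> norm z" by fastforce
    then show ?thesis
    proof cases
      case 2
      obtain j0 where "(1/2::real)^j0 < norm z"
        using real_arch_pow_inv[OF 2(1), of "1/2"] by auto
      moreover have "(1/2::real)^Suc j0 \<le> (1/2)^j0" by simp
      ultimately have ex: "(1/2::real)^Suc j0 \<le> norm z" by linarith
      define j where "j = (LEAST j. (1/2::real)^Suc j \<le> norm z)"
      have j1: "(1/2)^Suc j \<le> norm z" unfolding j_def using ex by (rule LeastI)
      have j2: "norm z < (1/2)^j"
      proof (cases j)
        case 0 with 2 show ?thesis by simp
      next
        case (Suc i)
        then have "\<not> (1/2)^Suc i \<le> norm z" unfolding j_def by (metis lessI not_less_Least)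
        with Suc show ?thesis by simp
      qed
      have "?k z \<le> (1/4)^j / (1 / P) ^ Suc j"
      proof (rule frac_le)
        have "(norm z)\<^sup>2 \<le> ((1/2)^j)\<^sup>2" using j2 by (intro power_mono) auto
        also have "\<dots> = (1/4::real)^j" by (simp add: power2_eq_square power_mult_distrib[symmetric])
        finally show "min ((norm z)\<^sup>2) 1 \<le> (1/4)^j" by simp
        show "(1 / P) ^ Suc j \<le> norm z powr ?p"
          unfolding half[symmetric] using j1 assms by (intro powr_mono2) auto
      qed (use P in auto)
      also have "\<dots> = c1 j" using P by (simp add: c1_def power_one_over)
      finally have "ennreal (?k z) \<le> ?f1 z" using j2 by (intro le_suminf_indicator[of z _ j]) auto
      then show ?thesis by (simp add: add_increasing2)
    next
      case 3
      obtain j0 where "norm z < (2::real)^j0"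
        using real_arch_pow[of 2 "norm z"] by auto
      moreover have "(2::real)^j0 \<le> 2^Suc j0" by simp
      ultimately have ex: "norm z < (2::real)^Suc j0" by linarith
      define j where "j = (LEAST j. norm z < (2::real)^Suc j)"
      have j1: "norm z < 2^Suc j" unfolding j_def using ex by (rule LeastI)
      have j2: "2^j \<le> norm z"
      proof (cases j)
        case 0 with 3 show ?thesis by simp
      next
        case (Suc i)
        then have "\<not> norm z < 2^Suc i" unfolding j_def by (metis lessI not_less_Least)
        with Suc show ?thesis by simp
      qed
      have "?k z \<le> 1 / P ^ j"
      proof (rule frac_le)
        have "P ^ j = (2 ^ j) powr ?p" by (simp add: power_powr_eq P_def)
        also have "\<dots> \<le> norm z powr ?p" using j2 assms by (intro powr_mono2) auto
        finally show "P ^ j \<le> norm z powr ?p" .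
      qed (use P in auto)
      also have "\<dots> = c2 j" by (simp add: c2_def power_one_over)
      finally have "ennreal (?k z) \<le> ?f2 z" using j1 by (intro le_suminf_indicator[of z _ j]) auto
      then show ?thesis by (simp add: add_increasing)
    qed simp
  qed
  have "(\<integral>\<^sup>+ z. ?f1 z \<partial>lborel) < \<infinity>"
  proof (rule nn_integral_dyadic_finite[where A = P and q = "2 powr (2 * s) / 4"])
    show "c1 j * ((1/2)^j) ^ DIM('a) = P * (2 powr (2 * s) / 4) ^ j" for j
    proof -
      have "((1/2::real)^j) ^ DIM('a) = ((1/2) ^ DIM('a)) ^ j"
        by (simp only: power_mult[symmetric] mult.commute)
      then have "c1 j * ((1/2)^j) ^ DIM('a) = P * (1/4 * P * (1/2) ^ DIM('a)) ^ j"
        unfolding c1_def by (simp only: power_mult_distrib power_Suc ac_simps)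
      also have "1/4 * P * (1/2) ^ DIM('a) = 2 powr (2 * s) / 4"
        unfolding Pn by (simp add: power_one_over)
      finally show ?thesis .
    qed
    have "2 powr (2 * s) < 2 powr 2" using assms by (intro powr_less_mono) auto
    then show "2 powr (2 * s) / 4 < (1::real)" by simp
  qed (use P in \<open>auto simp: c1_def\<close>)
  moreover have "(\<integral>\<^sup>+ z. ?f2 z \<partial>lborel) < \<infinity>"
  proof (rule nn_integral_dyadic_finite[where A = "2 ^ DIM('a)" and q = "1 / 2 powr (2 * s)"])
    show "c2 j * (2^Suc j) ^ DIM('a) = 2 ^ DIM('a) * (1 / 2 powr (2 * s)) ^ j" for j
    proof -
      have "((2::real)^j) ^ DIM('a) = (2 ^ DIM('a)) ^ j"
        by (simp only: power_mult[symmetric] mult.commute)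
      then have "c2 j * (2^Suc j) ^ DIM('a) = 2 ^ DIM('a) * (1 / P * 2 ^ DIM('a)) ^ j"
        unfolding c2_def by (simp only: power_mult_distrib power_Suc ac_simps)
      also have "1 / P * 2 ^ DIM('a) = 1 / 2 powr (2 * s)"
        unfolding Pn by simp
      finally show ?thesis .
    qed
    have "2 powr 0 < (2::real) powr (2 * s)" using assms by (intro powr_less_mono) auto
    then show "1 / 2 powr (2 * s) < (1::real)" by simp
  qed (use P in \<open>auto simp: c2_def\<close>)
  moreover have "?f1 \<in> borel_measurable lborel" "?f2 \<in> borel_measurable lborel"
    by (intro borel_measurable_suminf_order borel_measurable_times_ennreal borel_measurable_const
        borel_measurable_indicator, simp)+
  ultimately have "(\<integral>\<^sup>+ z. ?f1 z + ?f2 z \<partial>lborel) < \<infinity>"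
    by (subst nn_integral_add) (simp_all only: infinity_ennreal_def ennreal_add_less_top)
  then show ?thesis
    using nn_integral_mono[of lborel "\<lambda>z. ennreal (?k z)" "\<lambda>z. ?f1 z + ?f2 z", OF le] le_less_trans by blast
qed

lemma nn_integral_lborel_translate:
  fixes f :: "'a::euclidean_space \<Rightarrow> ennreal"
  assumes "f \<in> borel_measurable borel"
  shows "(\<integral>\<^sup>+ y. f (y - x) \<partial>lborel) = (\<integral>\<^sup>+ y. f y \<partial>lborel)"
proof -
  have "(\<integral>\<^sup>+ y. f y \<partial>lborel) = (\<integral>\<^sup>+ y. f y \<partial>(distr lborel borel ((+) (- x))))"
    by (simp add: lborel_distr_plus)
  also have "\<dots> = (\<integral>\<^sup>+ y. f (- x + y) \<partial>lborel)"
    using assms by (subst nn_integral_distr) auto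
  finally show ?thesis by simp
qed

context bounded_open_set
begin

text \<open>The squared increment is at most (L^2 + 1) min(|x-y|^2, 1) and vanishes unless x or y
  lies in D. Translating the kernel to the point in D bounds the double integral by 2 |D| times a
  finite integral.\<close>

lemma Lipschitz_in_Hs0:
  fixes \<phi> :: "'a \<Rightarrow> real"
  assumes Lip: "\<And>x y. \<bar>\<phi> x - \<phi> y\<bar> \<le> L * norm (x - y)"
    and bd: "\<And>x. 0 \<le> \<phi> x" "\<And>x. \<phi> x \<le> 1" and off: "\<And>x. x \<notin> D \<Longrightarrow> \<phi> x = 0"
  shows "\<phi> \<in> Hs0 s D"
proof -
  let ?p = "real DIM('a) + 2 * s"
  define k where "k z = min ((norm z)\<^sup>2) 1 / norm z powr ?p" for z :: 'a
  have [measurable]: "k \<in> borel_measurable borel" unfolding k_def by measurable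
  define M where "M = L\<^sup>2 + 1"
  have M: "0 \<le> M" by (simp add: M_def)
  have "continuous_on UNIV \<phi>"
  proof (rule continuous_onI)
    fix x e :: real and a :: 'a assume "0 < e"
    show "\<exists>d>0. \<forall>x'\<in>UNIV. dist x' a < d \<longrightarrow> dist (\<phi> x') (\<phi> a) \<le> e"
    proof (intro exI conjI ballI impI)
      \<comment> \<open>\<open>L\<close> carries no sign assumption and may be 0, hence this
        divisor.\<close>
      show "0 < e / (\<bar>L\<bar> + 1)" using \<open>0 < e\<close> by simp
      fix x' assume "dist x' a < e / (\<bar>L\<bar> + 1)"
      then have "(\<bar>L\<bar> + 1) * norm (x' - a) < e" by (simp add: dist_norm field_simps)
      moreover have "L * norm (x' - a) \<le> (\<bar>L\<bar> + 1) * norm (x' - a)" by (intro mult_right_mono) auto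
      ultimately show "dist (\<phi> x') (\<phi> a) \<le> e" using Lip[of x' a] by (simp add: dist_real_def)
    qed
  qed
  then have [measurable]: "\<phi> \<in> borel_measurable borel" by (rule borel_measurable_continuous_onI)
  then have meas: "\<phi> \<in> borel_measurable lebesgue" by (simp add: measurable_completion)
  have "integrable lebesgue (\<lambda>x. (\<phi> x)\<^sup>2)"
  proof (rule Bochner_Integration.integrable_bound)
    show "integrable lebesgue (indicator D :: 'a \<Rightarrow> real)"
      using emeasure_D_finite by (simp add: integrable_indicator_iff)
    show "AE x in lebesgue. norm ((\<phi> x)\<^sup>2) \<le> norm (indicator D x :: real)"
      using bd off by (intro AE_I2) (auto simp: indicator_def power_le_one)
  qed (use meas in simp)
  moreover have "gagliardo_sq s \<phi> < \<infinity>"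
  proof -
    let ?g1 = "\<lambda>z::'a \<times> 'a. indicator D (fst z) * ennreal (M * k (snd z - fst z))"
    let ?g2 = "\<lambda>z::'a \<times> 'a. indicator D (snd z) * ennreal (M * k (fst z - snd z))"
    have I: "(\<integral>\<^sup>+ z. ennreal (M * k z) \<partial>lborel) < \<infinity>"
    proof -
      have "(\<integral>\<^sup>+ z. ennreal (M * k z) \<partial>lborel) = ennreal M * (\<integral>\<^sup>+ z. ennreal (k z) \<partial>lborel)"
        using M by (subst nn_integral_cmult[symmetric]) (auto simp: ennreal_mult')
      then show ?thesis
        using nn_integral_fractional_kernel_finite[OF s_pos s_less_1, where 'a='a]
        unfolding k_def by (simp add: ennreal_mult_less_top)
    qed
    have I': "(\<integral>\<^sup>+ y. indicator D x * ennreal (M * k (y - x)) \<partial>lborel)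
        = indicator D x * (\<integral>\<^sup>+ z. ennreal (M * k z) \<partial>lborel)" for x
      by (simp add: nn_integral_cmult nn_integral_lborel_translate[of "\<lambda>z. ennreal (M * k z)"])
    have fin: "(\<integral>\<^sup>+ x. indicator D x * (\<integral>\<^sup>+ z. ennreal (M * k z) \<partial>lborel) \<partial>lborel) < \<infinity>"
      using I emeasure_D_finite by (simp add: nn_integral_multc ennreal_mult_less_top)
    have "gagliardo_sq s \<phi> = (\<integral>\<^sup>+ z. ennreal ((dquot s \<phi> z)\<^sup>2) \<partial>(lborel \<Otimes>\<^sub>M lborel))"
      by (simp add: gagliardo_sq_dquot nn_integral_completion lborel_prod)
    also have "\<dots> \<le> (\<integral>\<^sup>+ z. ?g1 z + ?g2 z \<partial>(lborel \<Otimes>\<^sub>M lborel))"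
    proof (rule nn_integral_mono)
      fix z :: "'a \<times> 'a"
      obtain x y where z: "z = (x, y)" by fastforce
      have sq: "(\<phi> x - \<phi> y)\<^sup>2 \<le> M * min ((norm (x - y))\<^sup>2) 1"
      proof -
        have "(\<phi> x - \<phi> y)\<^sup>2 \<le> L\<^sup>2 * (norm (x - y))\<^sup>2"
          using power_mono[OF Lip[of x y], of 2] by (simp add: power_mult_distrib)
        moreover have "(\<phi> x - \<phi> y)\<^sup>2 \<le> 1"
          using bd[of x] bd[of y] by (simp add: abs_square_le_1 abs_le_iff)
        moreover have "L\<^sup>2 * (norm (x - y))\<^sup>2 \<le> M * (norm (x - y))\<^sup>2" "1 \<le> M"
          by (auto simp: M_def intro: mult_right_mono)
        ultimately show ?thesis by (simp add: min_def)
      qed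
      have "(dquot s \<phi> z)\<^sup>2 \<le> M * k (x - y)"
        using divide_right_mono[OF sq, of "norm (x - y) powr ?p"] by (simp add: dquot_sq z k_def)
      moreover have "k (y - x) = k (x - y)" by (simp add: k_def norm_minus_commute)
      moreover have "(dquot s \<phi> z)\<^sup>2 = 0" if "x \<notin> D" "y \<notin> D"
        using off that by (simp add: dquot_sq z)
      ultimately show "ennreal ((dquot s \<phi> z)\<^sup>2) \<le> ?g1 z + ?g2 z"
        by (auto simp: z indicator_def ennreal_leI add_increasing2)
    qed
    also have "\<dots> = (\<integral>\<^sup>+ z. ?g1 z \<partial>(lborel \<Otimes>\<^sub>M lborel)) + (\<integral>\<^sup>+ z. ?g2 z \<partial>(lborel \<Otimes>\<^sub>M lborel))"
      by (rule nn_integral_add) measurable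
    also have "\<dots> < \<infinity>"
    proof -
      have "(\<integral>\<^sup>+ z. ?g1 z \<partial>(lborel \<Otimes>\<^sub>M lborel)) < \<infinity>"
        using fin by (subst lborel.nn_integral_fst[symmetric]) (simp_all add: I')
      moreover have "(\<integral>\<^sup>+ z. ?g2 z \<partial>(lborel \<Otimes>\<^sub>M lborel)) < \<infinity>"
        using fin by (subst lborel_pair.nn_integral_snd[symmetric]) (simp_all add: I')
      ultimately show ?thesis by simp
    qed
    finally show ?thesis .
  qed
  ultimately show ?thesis using meas off by (simp add: Hs0_def Hs_def)
qed

text \<open>The Lipschitz functions min(1, k dist(x, complement of U)) are admissible tests and
  converge pointwise to the indicator of \<open>U\<close>; dominated convergence passes the
  inequality to the limit.\<close>

lemma integral_open_subset_nonpos: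
  assumes [measurable]: "h \<in> borel_measurable (lebesgue_on D)" and h: "AE x in lebesgue_on D. \<bar>h x\<bar> \<le> C"
    and test: "\<And>\<phi>. \<phi> \<in> Hs0 s D \<Longrightarrow> (\<And>x. 0 \<le> \<phi> x) \<Longrightarrow> (\<And>x. \<phi> x \<le> 1) \<Longrightarrow>
      (\<integral>x. h x * \<phi> x \<partial>lebesgue_on D) \<le> 0"
    and U: "open U" "U \<subseteq> D"
  shows "(\<integral>x. h x * indicator U x \<partial>lebesgue_on D) \<le> 0"
proof -
  \<comment> \<open>\<open>infdist\<close> to the empty set is 0 by convention, so the cut-offs
    would vanish identically if \<open>U\<close> were the whole space.\<close>
  have ne: "- U \<noteq> {}"
    using U(2) bounded_D bounded_subset not_bounded_UNIV[where 'a='a] by (metis Compl_UNIV_eq double_complement)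
  define \<phi> where "\<phi> k x = min 1 (real k * infdist x (- U))" for k x
  have bd: "0 \<le> \<phi> k x" "\<phi> k x \<le> 1" for k x by (auto simp: \<phi>_def infdist_nonneg)
  have \<phi>: "\<phi> k \<in> Hs0 s D" for k
  proof (rule Lipschitz_in_Hs0[of _ "real k"])
    show "\<bar>\<phi> k x - \<phi> k y\<bar> \<le> real k * norm (x - y)" for x y
    proof -
      have "\<bar>infdist x (- U) - infdist y (- U)\<bar> \<le> norm (x - y)"
        using infdist_triangle[of x "- U" y] infdist_triangle[of y "- U" x] by (auto simp: dist_norm norm_minus_commute)
      then have "real k * \<bar>infdist x (- U) - infdist y (- U)\<bar> \<le> real k * norm (x - y)"
        by (rule mult_left_mono) simp
      then have "\<bar>real k * infdist x (- U) - real k * infdist y (- U)\<bar> \<le> real k * norm (x - y)"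
        by (simp add: right_diff_distrib[symmetric] abs_mult)
      moreover have "\<bar>min 1 a - min 1 b\<bar> \<le> \<bar>a - b\<bar>" for a b :: real by auto
      ultimately show ?thesis unfolding \<phi>_def using order_trans by blast
    qed
    show "\<phi> k x = 0" if "x \<notin> D" for x
    proof -
      have "x \<in> - U" using that U(2) by auto
      from infdist_zero[OF this] show ?thesis by (simp add: \<phi>_def)
    qed
  qed (rule bd)+
  have [measurable]: "\<phi> k \<in> borel_measurable (lebesgue_on D)" for k
    using sq_int_Hs0(1)[OF \<phi>[of k]] by (simp add: sq_int_def)
  have [measurable]: "U \<in> sets (lebesgue_on D)"
    using U D_sets by (subst sets_restrict_space_iff) auto
  have lim: "(\<lambda>k. \<phi> k x) \<longlonglongrightarrow> indicator U x" for x
  proof (cases "x \<in> U")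
    case False
    then show ?thesis by (simp add: \<phi>_def)
  next
    case True
    have "infdist x (- U) \<noteq> 0" using True U(1) in_closed_iff_infdist_zero[of "- U" x] ne by auto
    then have pos: "0 < infdist x (- U)" using infdist_nonneg[of x "- U"] by linarith
    obtain N where N: "1 < real N * infdist x (- U)" using ex_less_of_nat_mult[OF pos] by blast
    have "\<phi> k x = indicator U x" if "N \<le> k" for k
    proof -
      have "real N * infdist x (- U) \<le> real k * infdist x (- U)"
        using that pos by (intro mult_right_mono) auto
      then show ?thesis using N True by (simp add: \<phi>_def)
    qed
    then show ?thesis by (intro tendsto_eventually) (auto simp: eventually_sequentially)
  qed
  have "(\<lambda>k. \<integral>x. h x * \<phi> k x \<partial>lebesgue_on D) \<longlonglongrightarrow> (\<integral>x. h x * indicator U x \<partial>lebesgue_on D)"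
  proof (rule integral_dominated_convergence[where w = "\<lambda>x. \<bar>C\<bar>"])
    show "integrable (lebesgue_on D) (\<lambda>x. \<bar>C\<bar>)" using finite_measure.integrable_const[OF finite_measure_D] .
    show "AE x in lebesgue_on D. (\<lambda>k. h x * \<phi> k x) \<longlonglongrightarrow> h x * indicator U x"
      by (intro AE_I2 tendsto_mult tendsto_const lim)
    show "AE x in lebesgue_on D. norm (h x * \<phi> k x) \<le> \<bar>C\<bar>" for k
      using h
    proof eventually_elim
      case (elim x)
      have "\<bar>h x\<bar> * \<phi> k x \<le> C * 1" using elim bd by (intro mult_mono) auto
      then show ?case using bd[of k x] by (simp add: abs_mult)
    qed
  qed measurable
  then show ?thesis
    using test[OF \<phi> bd] by (intro LIMSEQ_le_const2) auto
qed

text \<open>The fundamental lemma of the calculus of variations in one-sided form. The set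
  \<open>E\<close> where h > 0 is enclosed in an open \<open>U\<close> with little excess; the
  integral of h over \<open>U\<close> is nonpositive and differs from that over \<open>E\<close> by
  at most \<open>\<bar>C\<bar>\<close> times the excess. One-sidedness is what the contact set
  estimate requires.\<close>

lemma AE_nonpos_if_tested:
  assumes h[measurable]: "h \<in> borel_measurable (lebesgue_on D)" and bd: "AE x in lebesgue_on D. \<bar>h x\<bar> \<le> C"
    and test: "\<And>\<phi>. \<phi> \<in> Hs0 s D \<Longrightarrow> (\<And>x. 0 \<le> \<phi> x) \<Longrightarrow> (\<And>x. \<phi> x \<le> 1) \<Longrightarrow>
      (\<integral>x. h x * \<phi> x \<partial>lebesgue_on D) \<le> 0"
  shows "AE x in lebesgue_on D. h x \<le> 0"
proof -
  let ?M = "lebesgue_on D"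
  define E where "E = {x \<in> space ?M. 0 < h x}"
  have EM[measurable]: "E \<in> sets ?M" unfolding E_def by measurable
  then have E: "E \<in> sets lebesgue" "E \<subseteq> D"
    using sets_restrict_space_iff[of D lebesgue E] D_sets by auto
  have int: "integrable ?M (\<lambda>x. h x * indicator S x)" if [measurable]: "S \<in> sets ?M" for S
  proof (rule finite_measure.integrable_const_bound[OF finite_measure_D, where B = C])
    show "AE x in ?M. norm (h x * indicator S x) \<le> C"
      using bd by eventually_elim (auto simp: indicator_def)
  qed measurable
  have le: "(\<integral>x. h x * indicator E x \<partial>?M) \<le> \<bar>C\<bar> * e" if "0 < e" for e
  proof -
    obtain T where T: "open T" "E \<subseteq> T" "T - E \<in> lmeasurable" "emeasure lebesgue (T - E) < ennreal e"
      using sets_lebesgue_outer_open[OF E(1) \<open>0 < e\<close>] by blast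
    define U where "U = T \<inter> D"
    have U: "open U" "U \<subseteq> D" "E \<subseteq> U" using T open_D E by (auto simp: U_def)
    have U'[measurable]: "U \<in> sets ?M"
      using U(1,2) D_sets by (subst sets_restrict_space_iff) auto
    have [measurable]: "(indicator (T - E) :: 'a \<Rightarrow> real) \<in> borel_measurable ?M"
      using T(3) by (intro measurable_restrict_space1) auto
    have iT: "integrable ?M (\<lambda>x. \<bar>C\<bar> * indicator (T - E) x)"
    proof (rule finite_measure.integrable_const_bound[OF finite_measure_D, where B = "\<bar>C\<bar>"])
      show "AE x in ?M. norm (\<bar>C\<bar> * indicator (T - E) x) \<le> \<bar>C\<bar>"
        by (intro AE_I2) (auto simp: indicator_def)
    qed measurable
    have "(\<integral>x. h x * indicator E x \<partial>?M) \<le> (\<integral>x. h x * indicator U x + \<bar>C\<bar> * indicator (T - E) x \<partial>?M)"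
    proof (rule integral_mono_AE)
      show "integrable ?M (\<lambda>x. h x * indicator E x)" by (rule int[OF EM])
      show "integrable ?M (\<lambda>x. h x * indicator U x + \<bar>C\<bar> * indicator (T - E) x)"
        using int[OF U'] iT by simp
      show "AE x in ?M. h x * indicator E x \<le> h x * indicator U x + \<bar>C\<bar> * indicator (T - E) x"
        using bd by eventually_elim (use U(3) in \<open>auto simp: indicator_def U_def\<close>)
    qed
    also have "\<dots> = (\<integral>x. h x * indicator U x \<partial>?M) + \<bar>C\<bar> * (\<integral>x. indicator (T - E) x \<partial>?M)"
      using int[OF U'] iT by simp
    also have "\<dots> \<le> 0 + \<bar>C\<bar> * e"
    proof (intro add_mono mult_left_mono)
      show "(\<integral>x. h x * indicator U x \<partial>?M) \<le> 0"
        by (rule integral_open_subset_nonpos[OF h bd test U(1,2)])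
      have "(\<integral>x. indicator (T - E) x \<partial>?M) = (\<integral>x. (indicator D x * indicator (T - E) x :: real) \<partial>lebesgue)"
        by (rule integral_lebesgue_on_eq[OF D_sets(1)])
      also have "\<dots> \<le> (\<integral>x. indicator (T - E) x \<partial>lebesgue)"
      proof (rule integral_mono)
        show i: "integrable lebesgue (indicator (T - E) :: 'a \<Rightarrow> real)"
          using T(3) unfolding fmeasurable_def by (intro integrable_real_indicator) blast+
        show "integrable lebesgue (\<lambda>x. indicator D x * indicator (T - E) x :: real)"
        proof (rule Bochner_Integration.integrable_bound[OF i])
          show "(\<lambda>x. indicator D x * indicator (T - E) x :: real) \<in> borel_measurable lebesgue"
            using T(3) by (intro borel_measurable_times borel_measurable_indicator D_sets) auto
        qed (auto simp: indicator_def)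
      qed (auto simp: indicator_def)
      also have "\<dots> = measure lebesgue (T - E)" by simp
      also have "\<dots> \<le> e" using T(3,4) \<open>0 < e\<close> by (simp add: emeasure_eq_measure2 ennreal_less_iff)
      finally show "(\<integral>x. indicator (T - E) x \<partial>?M) \<le> e" .
    qed auto
    finally show ?thesis by simp
  qed
  have "(\<integral>x. h x * indicator E x \<partial>?M) \<le> 0"
  proof (rule field_le_epsilon)
    fix e :: real assume "0 < e"
    then have "(\<integral>x. h x * indicator E x \<partial>?M) \<le> \<bar>C\<bar> * (e / (\<bar>C\<bar> + 1))" by (intro le) simp
    also have "\<dots> \<le> e" using \<open>0 < e\<close> by (simp add: field_simps)
    finally show "(\<integral>x. h x * indicator E x \<partial>?M) \<le> 0 + e" by simp
  qed
  moreover have nn: "AE x in ?M. 0 \<le> h x * indicator E x"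
    by (intro AE_I2) (auto simp: indicator_def E_def)
  ultimately have "(\<integral>x. h x * indicator E x \<partial>?M) = 0"
    using integral_nonneg_AE[OF nn] by linarith
  then have "AE x in ?M. h x * indicator E x = 0"
    using integral_nonneg_eq_0_iff_AE[OF int[OF EM] nn] by simp
  moreover have "AE x in ?M. x \<in> space ?M" by (rule AE_space)
  ultimately show ?thesis by eventually_elim (auto simp: E_def indicator_def split: if_splits)
qed

section \<open>Existence and uniqueness of the minimizer\<close>

lemma AE_on_D_iff: "(AE x in lebesgue_on D. P x) \<longleftrightarrow> (AE x in lebesgue. x \<in> D \<longrightarrow> P x)"
  by (subst AE_restrict_space_iff) auto

lemma AE_on_D: "(AE x in lebesgue. P x) \<Longrightarrow> AE x in lebesgue_on D. P x"
  by (auto elim!: eventually_mono simp: AE_on_D_iff)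

lemma integral_const_D: "(\<integral>x. c \<partial>lebesgue_on D) = c * measure lebesgue D" for c :: real
  by (simp add: measure_restrict_space mult.commute)

lemma AE_zero_if_tested:
  assumes [measurable]: "h \<in> borel_measurable (lebesgue_on D)" and bd: "AE x in lebesgue_on D. \<bar>h x\<bar> \<le> C"
    and test: "\<And>\<phi>. \<phi> \<in> Hs0 s D \<Longrightarrow> (\<integral>x. h x * \<phi> x \<partial>lebesgue_on D) = 0"
  shows "AE x in lebesgue_on D. h x = 0"
proof -
  have "AE x in lebesgue_on D. h x \<le> 0"
    by (rule AE_nonpos_if_tested[OF assms(1) bd]) (simp add: test)
  moreover have "AE x in lebesgue_on D. - h x \<le> 0"
    by (rule AE_nonpos_if_tested[of _ C]) (use bd in \<open>simp_all add: test\<close>)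
  ultimately show ?thesis by eventually_elim auto
qed

section \<open>The admissible set and the energy as a quadratic form of the source\<close>

lemma Rbar_iff: "f \<in> Rbar D \<beta> \<longleftrightarrow> f \<in> borel_measurable (lebesgue_on D) \<and>
    (AE x in lebesgue_on D. 0 \<le> f x \<and> f x \<le> 1) \<and> (\<integral>x. f x \<partial>lebesgue_on D) = \<beta>"
proof -
  have "\<exists>C. AE x in lebesgue_on D. \<bar>f x\<bar> \<le> C" if "AE x in lebesgue_on D. 0 \<le> f x \<and> f x \<le> 1"
    by (rule exI[of _ 1]) (use that in \<open>eventually_elim, auto\<close>)
  then show ?thesis unfolding Rbar_def Linfty_def by auto
qed

lemma sq_int_unit_bounded:
  assumes "f \<in> borel_measurable (lebesgue_on D)" "AE x in lebesgue_on D. 0 \<le> f x \<and> f x \<le> 1"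
  shows "sq_int f"
  using assms(1)
proof (rule sq_int_bounded)
  show "AE x in lebesgue_on D. \<bar>f x\<bar> \<le> 1" using assms(2) by eventually_elim auto
qed

lemma sq_int_Rbar: "f \<in> Rbar D \<beta> \<Longrightarrow> sq_int f"
  unfolding Rbar_iff by (rule sq_int_unit_bounded) auto

lemma Rbar_convex:
  assumes f: "f \<in> Rbar D \<beta>" and g: "g \<in> Rbar D \<beta>" and t: "0 \<le> t" "t \<le> 1"
  shows "(\<lambda>x. (1 - t) * f x + t * g x) \<in> Rbar D \<beta>"
proof -
  have [measurable]: "f \<in> borel_measurable (lebesgue_on D)" "g \<in> borel_measurable (lebesgue_on D)"
    using f g by (auto simp: Rbar_iff)
  have "AE x in lebesgue_on D. 0 \<le> f x \<and> f x \<le> 1" "AE x in lebesgue_on D. 0 \<le> g x \<and> g x \<le> 1"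
    using f g by (auto simp: Rbar_iff)
  then have "AE x in lebesgue_on D. 0 \<le> (1 - t) * f x + t * g x \<and> (1 - t) * f x + t * g x \<le> 1"
  proof eventually_elim
    case (elim x)
    have "(1 - t) * f x + t * g x \<le> (1 - t) * 1 + t * 1"
      using elim t by (intro add_mono mult_left_mono) auto
    then show ?case using elim t by simp
  qed
  moreover have "(\<integral>x. (1 - t) * f x + t * g x \<partial>lebesgue_on D) = \<beta>"
    using f g sq_int_integrable[OF sq_int_Rbar[OF f]] sq_int_integrable[OF sq_int_Rbar[OF g]]
    by (simp add: Rbar_iff algebra_simps)
  ultimately show ?thesis by (simp add: Rbar_iff)
qed

text \<open>A real-valued stand-in for \<open>Phi\<close>, which takes values in
  \<open>ennreal\<close>, so that quadratic expansions with subtraction are possible.\<close>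

definition energy :: "('a \<Rightarrow> real) \<Rightarrow> real"
  where "energy f = gagliardo_form s (solution s D f) (solution s D f)"

lemma energy_nonneg: "0 \<le> energy f"
  unfolding energy_def by (rule gagliardo_form_self_nonneg)

lemma Phi_eq_energy: "sq_int f \<Longrightarrow> Phi s D f = ennreal (energy f)"
  unfolding energy_def by (intro Phi_weak_solution weak_solution_solution)

lemma minimizer_iff: "minimizer s D \<beta> f \<longleftrightarrow> f \<in> Rbar D \<beta> \<and> (\<forall>g\<in>Rbar D \<beta>. energy f \<le> energy g)"
  unfolding minimizer_def using Phi_eq_energy[OF sq_int_Rbar] energy_nonneg by auto

lemma solution_Hs0: "sq_int f \<Longrightarrow> solution s D f \<in> Hs0 s D"
  using weak_solution_solution weak_solutionD(1) by blast

lemma form_solution: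
  assumes "sq_int f" "v \<in> Hs0 s D"
  shows "gagliardo_form s (solution s D f) v = 2 * (\<integral>x. f x * v x \<partial>lebesgue_on D)"
  using weak_solutionD(2)[OF weak_solution_solution[OF assms(1)] assms(2)] .

text \<open>\<open>solution\<close> is linear in the source only up to the choice of
  representatives; since the energy does not depend on that choice, it is still exactly
  quadratic.\<close>

lemma energy_lincomb:
  assumes f: "sq_int f" and g: "sq_int g"
  shows "energy (\<lambda>x. a * f x + b * g x) = a\<^sup>2 * energy f
    + 2 * a * b * gagliardo_form s (solution s D f) (solution s D g) + b\<^sup>2 * energy g"
proof -
  note H = Hs0_imp_Hs[OF solution_Hs0[OF f]] Hs0_imp_Hs[OF solution_Hs0[OF g]]
  have fg: "sq_int (\<lambda>x. a * f x + b * g x)" by (rule sq_int_lincomb[OF f g])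
  have "weak_solution s D (\<lambda>x. a * f x + b * g x) (\<lambda>x. a * solution s D f x + b * solution s D g x)"
    by (intro weak_solution_lincomb weak_solution_solution f g)
  from Phi_weak_solution[OF fg this]
  have "energy (\<lambda>x. a * f x + b * g x)
      = gagliardo_form s (\<lambda>x. a * solution s D f x + b * solution s D g x)
          (\<lambda>x. a * solution s D f x + b * solution s D g x)"
    unfolding Phi_eq_energy[OF fg] by (simp add: energy_nonneg gagliardo_form_self_nonneg)
  then show ?thesis unfolding gagliardo_form_self_lincomb[OF H] energy_def .
qed

lemma integral_mult_tendsto:
  assumes p: "\<And>j. p j \<in> Rbar D \<beta>" and f: "f \<in> borel_measurable (lebesgue_on D)"
    and lim: "AE x in lebesgue_on D. (\<lambda>j. p j x) \<longlonglongrightarrow> f x" and g: "integrable (lebesgue_on D) g"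
  shows "(\<lambda>j. \<integral>x. p j x * g x \<partial>lebesgue_on D) \<longlonglongrightarrow> (\<integral>x. f x * g x \<partial>lebesgue_on D)"
proof (rule integral_dominated_convergence[where w = "\<lambda>x. \<bar>g x\<bar>"])
  have [measurable]: "g \<in> borel_measurable (lebesgue_on D)" "p j \<in> borel_measurable (lebesgue_on D)" for j
    using g p[of j] by (auto simp: Rbar_iff)
  note f[measurable]
  show "(\<lambda>x. f x * g x) \<in> borel_measurable (lebesgue_on D)" by measurable
  show "(\<lambda>x. p j x * g x) \<in> borel_measurable (lebesgue_on D)" for j by measurable
  show "integrable (lebesgue_on D) (\<lambda>x. \<bar>g x\<bar>)" using g by simp
  show "AE x in lebesgue_on D. (\<lambda>j. p j x * g x) \<longlonglongrightarrow> f x * g x"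
    using lim by eventually_elim (intro tendsto_mult tendsto_const)
  show "AE x in lebesgue_on D. norm (p j x * g x) \<le> \<bar>g x\<bar>" for j
  proof -
    have "AE x in lebesgue_on D. 0 \<le> p j x \<and> p j x \<le> 1" using p[of j] by (simp add: Rbar_iff)
    then show ?thesis
    proof eventually_elim
      case (elim x)
      have "\<bar>p j x\<bar> * \<bar>g x\<bar> \<le> 1 * \<bar>g x\<bar>" using elim by (intro mult_right_mono) auto
      then show ?case by (simp add: abs_mult)
    qed
  qed
qed

lemma const_in_Rbar:
  assumes "0 < \<beta>" "\<beta> < measure lebesgue D"
  shows "(\<lambda>x. \<beta> / measure lebesgue D) \<in> Rbar D \<beta>"
  using assms unfolding Rbar_iff integral_const_D by simp

text \<open>Elements of almost minimal \<open>L\<^sup>2\<close> norm in the nested convex sets of \<open>1/(k+1)\<close>-minimizers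
  form a Cauchy sequence, again by the parallelogram law; this replaces weak compactness.\<close>

lemma minimizer_exists:
  assumes \<beta>: "0 < \<beta>" "\<beta> < measure lebesgue D"
  obtains f where "minimizer s D \<beta> f"
proof -
  let ?M = "lebesgue_on D"
  define m where "m = (INF f\<in>Rbar D \<beta>. energy f)"
  have bddm: "bdd_below (energy ` Rbar D \<beta>)" using energy_nonneg by (intro bdd_belowI[of _ 0]) auto
  have ne: "Rbar D \<beta> \<noteq> {}" using const_in_Rbar[OF \<beta>] by blast
  define C where "C k = {f \<in> Rbar D \<beta>. energy f < m + 1 / real (Suc k)}" for k
  define N where "N f = (\<integral>x. (f x)\<^sup>2 \<partial>?M)" for f :: "'a \<Rightarrow> real"
  have CR: "f \<in> Rbar D \<beta>" if "f \<in> C k" for f k using that by (simp add: C_def)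
  have Cne: "C k \<noteq> {}" for k
  proof -
    have "Inf (energy ` Rbar D \<beta>) < m + 1 / real (Suc k)" by (simp add: m_def)
    then show ?thesis using cInf_lessD[of "energy ` Rbar D \<beta>"] ne unfolding C_def by blast
  qed
  have Cmono: "C l \<subseteq> C k" if "k \<le> l" for k l
  proof -
    have "1 / real (Suc l) \<le> 1 / real (Suc k)" using that by (simp add: frac_le)
    then show ?thesis unfolding C_def by fastforce
  qed
  have Nnn: "0 \<le> N f" for f by (simp add: N_def)
  have Nle: "N f \<le> measure lebesgue D" if "f \<in> Rbar D \<beta>" for f
  proof -
    have "AE x in ?M. 0 \<le> f x \<and> f x \<le> 1" using that by (simp only: Rbar_iff)
    then have "AE x in ?M. (f x)\<^sup>2 \<le> 1"
      by eventually_elim (simp add: abs_square_le_1)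
    then have "N f \<le> (\<integral>x. 1 \<partial>?M)"
      unfolding N_def using sq_int_Rbar[OF that] sq_int_integrable[OF sq_int_bounded[of "\<lambda>x. 1" 1]]
      by (intro integral_mono_AE) (auto simp: sq_int_def)
    then show ?thesis using integral_const_D[of 1] by simp
  qed
  define d where "d k = (INF f\<in>C k. N f)" for k
  have bddN: "bdd_below (N ` C k)" for k using Nnn by (intro bdd_belowI[of _ 0]) auto
  have d_le: "d k \<le> N f" if "f \<in> C k" for f k
    unfolding d_def using bddN that by (rule cINF_lower)
  have "\<exists>f\<in>C k. N f < d k + 1 / real (Suc k)" for k
  proof -
    have "Inf (N ` C k) < d k + 1 / real (Suc k)" by (simp add: d_def)
    then show ?thesis using cInf_lessD[of "N ` C k"] Cne[of k] by blast
  qed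
  then obtain p where p: "\<And>k. p k \<in> C k" and Np: "\<And>k. N (p k) < d k + 1 / real (Suc k)"
    by metis
  have pR: "\<And>k. p k \<in> Rbar D \<beta>" using p CR by blast
  have "incseq d"
  proof (rule monoI)
    fix k l :: nat assume "k \<le> l"
    then show "d k \<le> d l" unfolding d_def by (intro cINF_superset_mono Cne bddN Cmono) auto
  qed
  moreover have "d k \<le> measure lebesgue D" for k
    using d_le[OF p[of k]] Nle[OF pR[of k]] by linarith
  ultimately obtain dl where dl: "d \<longlonglongrightarrow> dl" "\<And>k. d k \<le> dl"
    using incseq_convergent by blast
  \<comment> \<open>By the parallelogram law the squared distance of \<open>p k\<close> and
    \<open>p l\<close> is 2 N(p k) + 2 N(p l) - 4 N(midpoint). The midpoint lies in
    \<open>C k\<close>, so its \<open>N\<close> is at least \<open>d k\<close>, and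
    \<open>d l \<le> dl\<close> leaves this bound.\<close>
  define e where "e k = 2 * (dl - d k) + 4 * (1 / real (Suc k))" for k
  have inv: "(\<lambda>k. 1 / real (Suc k)) \<longlonglongrightarrow> 0"
    using LIMSEQ_inverse_real_of_nat by (simp add: inverse_eq_divide)
  have "e \<longlonglongrightarrow> 2 * (dl - dl) + 4 * 0" unfolding e_def by (intro tendsto_intros dl inv)
  then have e0: "e \<longlonglongrightarrow> 0" by simp
  have pm: "p k \<in> borel_measurable ?M" for k using pR[of k] by (simp add: Rbar_iff)
  have Cauchy: "(\<integral>\<^sup>+ x. ennreal ((p k x - p l x)\<^sup>2) \<partial>?M) \<le> ennreal (e k)" if kl: "k \<le> l" for k l
  proof -
    note S = sq_int_Rbar[OF pR[of k]] sq_int_Rbar[OF pR[of l]]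
    let ?mid = "\<lambda>x. (1 - 1/2) * p k x + 1/2 * p l x"
    have i: "integrable ?M (\<lambda>x. (p k x)\<^sup>2)" "integrable ?M (\<lambda>x. (p l x)\<^sup>2)"
      "integrable ?M (\<lambda>x. p k x * p l x)"
      using S sq_int_mult[OF S] by (auto simp: sq_int_def)
    have mid: "?mid \<in> C k"
    proof -
      have pl: "p l \<in> C k" using p Cmono[OF kl] by blast
      have "0 \<le> gagliardo_form s (\<lambda>x. 1 * solution s D (p k) x + (-1) * solution s D (p l) x)
          (\<lambda>x. 1 * solution s D (p k) x + (-1) * solution s D (p l) x)"
        by (rule gagliardo_form_self_nonneg)
      then have "2 * gagliardo_form s (solution s D (p k)) (solution s D (p l)) \<le> energy (p k) + energy (p l)"
        unfolding gagliardo_form_self_lincomb[OF Hs0_imp_Hs[OF solution_Hs0[OF S(1)]] Hs0_imp_Hs[OF solution_Hs0[OF S(2)]]] energy_def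
        by simp
      then have "energy ?mid \<le> (energy (p k) + energy (p l)) / 2"
        unfolding energy_lincomb[OF S] by (simp add: power2_eq_square field_simps)
      also have "\<dots> < m + 1 / real (Suc k)" using p[of k] pl unfolding C_def by simp
      finally show ?thesis using Rbar_convex[OF pR pR, of "1/2" k l] by (simp add: C_def)
    qed
    have "N ?mid = (\<integral>x. 1/4 * (p k x)\<^sup>2 + (1/2 * (p k x * p l x) + 1/4 * (p l x)\<^sup>2) \<partial>?M)"
      unfolding N_def by (rule Bochner_Integration.integral_cong) (auto simp: power2_eq_square algebra_simps)
    also have "\<dots> = 1/4 * N (p k) + 1/2 * (\<integral>x. p k x * p l x \<partial>?M) + 1/4 * N (p l)"
      unfolding N_def using i by simp
    finally have Nmid: "N ?mid = 1/4 * N (p k) + 1/2 * (\<integral>x. p k x * p l x \<partial>?M) + 1/4 * N (p l)" .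
    have i2: "integrable ?M (\<lambda>x. (p k x)\<^sup>2 + ((p l x)\<^sup>2 - 2 * (p k x * p l x)))"
      using i by simp
    have "(\<integral>\<^sup>+ x. ennreal ((p k x - p l x)\<^sup>2) \<partial>?M)
        = (\<integral>\<^sup>+ x. ennreal ((p k x)\<^sup>2 + ((p l x)\<^sup>2 - 2 * (p k x * p l x))) \<partial>?M)"
      by (rule nn_integral_cong) (simp add: power2_diff algebra_simps)
    also have "\<dots> = ennreal (\<integral>x. (p k x)\<^sup>2 + ((p l x)\<^sup>2 - 2 * (p k x * p l x)) \<partial>?M)"
    proof (rule nn_integral_eq_integral[OF i2], rule AE_I2)
      fix x
      have "(p k x)\<^sup>2 + ((p l x)\<^sup>2 - 2 * (p k x * p l x)) = (p k x - p l x)\<^sup>2"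
        by (simp add: power2_diff algebra_simps)
      then show "0 \<le> (p k x)\<^sup>2 + ((p l x)\<^sup>2 - 2 * (p k x * p l x))" by simp
    qed
    also have "(\<integral>x. (p k x)\<^sup>2 + ((p l x)\<^sup>2 - 2 * (p k x * p l x)) \<partial>?M)
        = N (p k) + N (p l) - 2 * (\<integral>x. p k x * p l x \<partial>?M)"
      unfolding N_def using i by simp
    also have "\<dots> \<le> e k"
    proof -
      define a b where "a = 1 / real (Suc k)" and "b = 1 / real (Suc l)"
      have "b \<le> a" using kl by (simp add: frac_le a_def b_def)
      moreover have "N (p k) < d k + a" "N (p l) < d l + b" using Np by (auto simp: a_def b_def)
      moreover have "e k = 2 * (dl - d k) + 4 * a" by (simp add: e_def a_def)
      ultimately show ?thesis using d_le[OF mid] dl(2)[of l] unfolding Nmid by argo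
    qed
    finally show ?thesis by (simp add: ennreal_leI)
  qed
  obtain r f where r: "strict_mono (r :: nat \<Rightarrow> nat)" and f[measurable]: "f \<in> borel_measurable ?M"
    and lim: "AE x in ?M. (\<lambda>j. p (r j) x) \<longlonglongrightarrow> f x"
    using L2_Cauchy_AE_subseq[OF pm Cauchy e0] by blast
  have pr: "\<And>j. p (r j) \<in> Rbar D \<beta>" using pR by blast
  have "AE x in ?M. \<forall>j. 0 \<le> p (r j) x \<and> p (r j) x \<le> 1"
    unfolding AE_all_countable using pr by (auto simp: Rbar_iff)
  then have f01: "AE x in ?M. 0 \<le> f x \<and> f x \<le> 1"
    using lim
  proof eventually_elim
    case (elim x)
    then show ?case by (intro conjI LIMSEQ_le_const[OF elim(2)] LIMSEQ_le_const2[OF elim(2)]) auto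
  qed
  have "(\<integral>x. f x \<partial>?M) = \<beta>"
  proof -
    have "(\<lambda>j. \<integral>x. p (r j) x * 1 \<partial>?M) \<longlonglongrightarrow> (\<integral>x. f x * 1 \<partial>?M)"
      by (intro integral_mult_tendsto[OF pr f lim] sq_int_integrable[OF sq_int_bounded[of "\<lambda>x. 1" 1]]) auto
    moreover have "(\<integral>x. p (r j) x * 1 \<partial>?M) = \<beta>" for j using pr[of j] by (simp add: Rbar_iff)
    ultimately show ?thesis by (simp add: LIMSEQ_const_iff)
  qed
  with f01 have fR: "f \<in> Rbar D \<beta>" by (simp add: Rbar_iff)
  note fS = sq_int_Rbar[OF fR]
  let ?u = "solution s D f"
  have u: "?u \<in> Hs0 s D" by (rule solution_Hs0[OF fS])
  \<comment> \<open>Lower semicontinuity by linearization: nonnegativity of the form at the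
    difference of the two solutions gives energy(p) >= 4 (integral of p u_f) - energy(f). The right
    side is affine in p, so it converges along the subsequence, and at p = f it equals
    energy(f).\<close>
  have "energy f \<le> m"
  proof (rule LIMSEQ_le)
    have "(\<lambda>j. 4 * (\<integral>x. p (r j) x * ?u x \<partial>?M) - energy f) \<longlonglongrightarrow> 4 * (\<integral>x. f x * ?u x \<partial>?M) - energy f"
      by (intro tendsto_intros integral_mult_tendsto[OF pr f lim] sq_int_integrable sq_int_Hs0 u)
    then show "(\<lambda>j. 4 * (\<integral>x. p (r j) x * ?u x \<partial>?M) - energy f) \<longlonglongrightarrow> energy f"
      using form_solution[OF fS u] by (simp add: energy_def)
    have "(\<lambda>j. 1 / real (Suc (r j))) \<longlonglongrightarrow> 0"
      using LIMSEQ_subseq_LIMSEQ[OF inv r] by (simp add: o_def)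
    from tendsto_add[OF tendsto_const this, of m]
    show "(\<lambda>j. m + 1 / real (Suc (r j))) \<longlonglongrightarrow> m" by simp
    have "4 * (\<integral>x. p (r j) x * ?u x \<partial>?M) - energy f \<le> m + 1 / real (Suc (r j))" for j
    proof -
      note S = sq_int_Rbar[OF pr[of j]]
      have "0 \<le> gagliardo_form s (\<lambda>x. 1 * solution s D (p (r j)) x + (-1) * ?u x)
          (\<lambda>x. 1 * solution s D (p (r j)) x + (-1) * ?u x)"
        by (rule gagliardo_form_self_nonneg)
      then have "2 * gagliardo_form s (solution s D (p (r j))) ?u - energy f \<le> energy (p (r j))"
        unfolding gagliardo_form_self_lincomb[OF Hs0_imp_Hs[OF solution_Hs0[OF S]] Hs0_imp_Hs[OF u]] energy_def
        by simp
      moreover have "energy (p (r j)) < m + 1 / real (Suc (r j))" using p[of "r j"] by (simp add: C_def)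
      ultimately show ?thesis using form_solution[OF S u] by simp
    qed
    then show "\<exists>N. \<forall>j\<ge>N. 4 * (\<integral>x. p (r j) x * ?u x \<partial>?M) - energy f \<le> m + 1 / real (Suc (r j))"
      by blast
  qed
  moreover have "m \<le> energy g" if "g \<in> Rbar D \<beta>" for g
    unfolding m_def using bddm that by (rule cINF_lower)
  ultimately have "minimizer s D \<beta> f" unfolding minimizer_iff using fR by (meson order_trans)
  then show thesis by (rule that)
qed

text \<open>By Cauchy-Schwarz a solution of zero energy is orthogonal to all of
  \<open>Hs0 s D\<close>, so its source integrates to 0 against every test function.\<close>

lemma form_zero_imp_zero:
  assumes f: "f \<in> borel_measurable (lebesgue_on D)" "AE x in lebesgue_on D. \<bar>f x\<bar> \<le> C"
    and u: "weak_solution s D f u" and Q: "gagliardo_form s u u \<le> 0"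
  shows "AE x in lebesgue_on D. f x = 0"
proof (rule AE_zero_if_tested[OF f])
  fix \<phi> assume \<phi>: "\<phi> \<in> Hs0 s D"
  have "gagliardo_form s u u = 0" using Q gagliardo_form_self_nonneg[of s u] by linarith
  then have "gagliardo_form s u \<phi> = 0"
    using gagliardo_form_Cauchy_Schwarz[OF Hs0_imp_Hs[OF weak_solutionD(1)[OF u]] Hs0_imp_Hs[OF \<phi>]] by simp
  then show "(\<integral>x. f x * \<phi> x \<partial>lebesgue_on D) = 0" using weak_solutionD(2)[OF u \<phi>] by simp
qed

text \<open>Both energies equal the minimum E, and the midpoint has energy at least E, which forces
  the mixed term to be at least E. The energy of g - f, namely 2E minus twice the mixed term, is
  then nonpositive.\<close>

lemma minimizer_unique:
  assumes f: "minimizer s D \<beta> f" and g: "minimizer s D \<beta> g"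
  shows "AE x in lebesgue_on D. g x = f x"
proof -
  have R: "f \<in> Rbar D \<beta>" "g \<in> Rbar D \<beta>" using f g by (auto simp: minimizer_iff)
  note S = sq_int_Rbar[OF R(1)] sq_int_Rbar[OF R(2)]
  have eq: "energy g = energy f" using f g unfolding minimizer_iff by (meson order_antisym)
  have "energy f \<le> energy (\<lambda>x. (1 - 1/2) * f x + 1/2 * g x)"
    using f Rbar_convex[OF R, of "1/2"] by (simp add: minimizer_iff)
  then have B: "energy f \<le> gagliardo_form s (solution s D f) (solution s D g)"
    unfolding energy_lincomb[OF S] eq by (simp add: power2_eq_square)
  have [measurable]: "f \<in> borel_measurable (lebesgue_on D)" "g \<in> borel_measurable (lebesgue_on D)"
    using R by (auto simp: Rbar_iff)
  have "AE x in lebesgue_on D. 1 * g x + (-1) * f x = 0"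
  proof (rule form_zero_imp_zero)
    show "weak_solution s D (\<lambda>x. 1 * g x + (-1) * f x) (\<lambda>x. 1 * solution s D g x + (-1) * solution s D f x)"
      by (rule weak_solution_lincomb[OF S(2,1) weak_solution_solution[OF S(2)] weak_solution_solution[OF S(1)]])
    show "gagliardo_form s (\<lambda>x. 1 * solution s D g x + (-1) * solution s D f x)
        (\<lambda>x. 1 * solution s D g x + (-1) * solution s D f x) \<le> 0"
      unfolding gagliardo_form_self_lincomb[OF Hs0_imp_Hs[OF solution_Hs0[OF S(2)]] Hs0_imp_Hs[OF solution_Hs0[OF S(1)]]]
      using B eq gagliardo_form_commute[of s "solution s D f" "solution s D g"] by (simp add: energy_def)
    have "AE x in lebesgue_on D. 0 \<le> f x \<and> f x \<le> 1" "AE x in lebesgue_on D. 0 \<le> g x \<and> g x \<le> 1"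
      using R by (auto simp: Rbar_iff)
    then show "AE x in lebesgue_on D. \<bar>1 * g x + (-1) * f x\<bar> \<le> 1" by eventually_elim auto
  qed simp
  then show ?thesis by eventually_elim simp
qed

text \<open>Expand the energy at (1 - t) f + t g, divide by t and let t = 1/(k+1) tend to 0.
  Symmetry of the form turns the mixed term \<open>b\<close> into a pairing of \<open>g\<close> with
  u_f, by testing the equation for \<open>g\<close> with u_f.\<close>

lemma minimizer_first_order:
  assumes f: "minimizer s D \<beta> f" and g: "g \<in> Rbar D \<beta>"
  shows "(\<integral>x. f x * solution s D f x \<partial>lebesgue_on D) \<le> (\<integral>x. g x * solution s D f x \<partial>lebesgue_on D)"
proof -
  have R: "f \<in> Rbar D \<beta>" using f by (simp add: minimizer_iff)
  note S = sq_int_Rbar[OF R] sq_int_Rbar[OF g]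
  define b where "b = gagliardo_form s (solution s D f) (solution s D g)"
  define c where "c = energy f - 2 * b + energy g"
  have "0 \<le> 2 * (b - energy f) + 1 / real (Suc k) * c" for k
  proof -
    define t where "t = 1 / real (Suc k)"
    have t: "0 < t" "t \<le> 1" by (auto simp: t_def)
    have "energy f \<le> energy (\<lambda>x. (1 - t) * f x + t * g x)"
      using f Rbar_convex[OF R g, of t] t by (simp add: minimizer_iff)
    also have "\<dots> = energy f + t * (2 * (b - energy f) + t * c)"
      unfolding energy_lincomb[OF S] b_def[symmetric] c_def by (simp add: power2_eq_square algebra_simps)
    finally have "0 \<le> t * (2 * (b - energy f) + t * c)" by simp
    then have "0 \<le> 2 * (b - energy f) + t * c" using t(1) by (simp add: zero_le_mult_iff)
    then show ?thesis by (simp add: t_def)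
  qed
  moreover have "(\<lambda>k. 2 * (b - energy f) + 1 / real (Suc k) * c) \<longlonglongrightarrow> 2 * (b - energy f) + 0 * c"
    using LIMSEQ_inverse_real_of_nat by (intro tendsto_intros) (simp add: inverse_eq_divide)
  ultimately have "0 \<le> 2 * (b - energy f) + 0 * c"
    by (intro LIMSEQ_le_const) auto
  moreover have "b = 2 * (\<integral>x. g x * solution s D f x \<partial>lebesgue_on D)"
    using form_solution[OF S(2) solution_Hs0[OF S(1)]] by (simp add: b_def gagliardo_form_commute)
  moreover have "energy f = 2 * (\<integral>x. f x * solution s D f x \<partial>lebesgue_on D)"
    using form_solution[OF S(1) solution_Hs0[OF S(1)]] by (simp add: energy_def)
  ultimately show ?thesis by simp
qed

section \<open>The bathtub principle and the contact set\<close>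

text \<open>If f had room below level \<open>a\<close> and mass above level \<open>b > a\<close>,
  moving mass from the high set to the low one would keep f admissible and strictly lower its
  pairing with u.\<close>

lemma bathtub_exchange:
  assumes f: "f \<in> Rbar D \<beta>" and u: "sq_int u"
    and opt: "\<And>g. g \<in> Rbar D \<beta> \<Longrightarrow> (\<integral>x. f x * u x \<partial>lebesgue_on D) \<le> (\<integral>x. g x * u x \<partial>lebesgue_on D)"
    and ab: "a < b"
  shows "(AE x in lebesgue_on D. \<not> (f x < 1 \<and> u x \<le> a)) \<or> (AE x in lebesgue_on D. \<not> (0 < f x \<and> b \<le> u x))"
proof -
  let ?M = "lebesgue_on D"
  have [measurable]: "f \<in> borel_measurable ?M" "u \<in> borel_measurable ?M"
    using f u by (auto simp: Rbar_iff sq_int_def)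
  have f01: "AE x in ?M. 0 \<le> f x \<and> f x \<le> 1" using f by (simp only: Rbar_iff)
  define p where "p x = (if f x < 1 \<and> u x \<le> a then 1 - f x else 0)" for x
  define q where "q x = (if 0 < f x \<and> b \<le> u x then f x else 0)" for x
  have [measurable]: "p \<in> borel_measurable ?M" "q \<in> borel_measurable ?M"
    unfolding p_def q_def by measurable
  have p01: "AE x in ?M. 0 \<le> p x \<and> p x \<le> 1" using f01 by eventually_elim (auto simp: p_def)
  have q01: "AE x in ?M. 0 \<le> q x \<and> q x \<le> 1" using f01 by eventually_elim (auto simp: q_def)
  have S: "sq_int p" "sq_int q" by (rule sq_int_unit_bounded, simp, rule p01 q01)+
  note i = sq_int_integrable[OF S(1)] sq_int_integrable[OF S(2)] sq_int_integrable[OF sq_int_Rbar[OF f]]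
  note iu = sq_int_mult[OF S(1) u] sq_int_mult[OF S(2) u] sq_int_mult[OF sq_int_Rbar[OF f] u]
  define P Q where "P = (\<integral>x. p x \<partial>?M)" and "Q = (\<integral>x. q x \<partial>?M)"
  have pnn: "AE x in ?M. 0 \<le> p x" using p01 by eventually_elim simp
  have qnn: "AE x in ?M. 0 \<le> q x" using q01 by eventually_elim simp
  have PQ: "0 \<le> P" "0 \<le> Q" unfolding P_def Q_def using pnn qnn by (auto intro: integral_nonneg_AE)
  have "P = 0 \<or> Q = 0"
  proof (rule ccontr)
    assume "\<not> (P = 0 \<or> Q = 0)"
    with PQ have pos: "0 < P" "0 < Q" by auto
    \<comment> \<open>The weights balance the mass added against the mass removed; being at most 1,
      they keep the competitor between 0 and 1.\<close>
    define t1 t2 where "t1 = Q / (P + Q)" and "t2 = P / (P + Q)"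
    have t: "0 \<le> t1" "t1 \<le> 1" "0 \<le> t2" "t2 \<le> 1" "t1 * P = t2 * Q" "0 < t1"
      using pos by (auto simp: t1_def t2_def)
    let ?g = "\<lambda>x. f x + (t1 * p x - t2 * q x)"
    have "?g \<in> Rbar D \<beta>"
      unfolding Rbar_iff
    proof (intro conjI)
      show "?g \<in> borel_measurable ?M" by measurable
      show "AE x in ?M. 0 \<le> ?g x \<and> ?g x \<le> 1"
        using f01
      proof eventually_elim
        case (elim x)
        have 1: "t1 * (1 - f x) \<le> 1 * (1 - f x)" "t2 * f x \<le> 1 * f x"
          using elim t by (intro mult_right_mono; simp)+
        have 2: "0 \<le> t1 * (1 - f x)" "0 \<le> t2 * f x" using elim t by auto
        consider "u x \<le> a" | "a < u x" "u x < b" | "b \<le> u x" by linarith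
        then show ?case
        proof cases
          case 1
          with ab have "q x = 0" "p x = 1 - f x" using elim by (auto simp: p_def q_def)
          then show ?thesis using elim \<open>t1 * (1 - f x) \<le> 1 * (1 - f x)\<close> 2 by simp
        next
          case 2
          then show ?thesis using elim by (simp add: p_def q_def)
        next
          case 3
          with ab have "p x = 0" "q x = f x" using elim by (auto simp: p_def q_def)
          then show ?thesis using elim 1 2 by simp
        qed
      qed
      show "(\<integral>x. ?g x \<partial>?M) = \<beta>"
        using i f t(5) by (simp add: Rbar_iff P_def[symmetric] Q_def[symmetric])
    qed
    from opt[OF this] have le: "(\<integral>x. f x * u x \<partial>?M) \<le> (\<integral>x. ?g x * u x \<partial>?M)" .
    have "(\<integral>x. ?g x * u x \<partial>?M) = (\<integral>x. f x * u x + (t1 * (p x * u x) - t2 * (q x * u x)) \<partial>?M)"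
      by (simp add: algebra_simps)
    also have "\<dots> = (\<integral>x. f x * u x \<partial>?M) + (t1 * (\<integral>x. p x * u x \<partial>?M) - t2 * (\<integral>x. q x * u x \<partial>?M))"
      using iu by simp
    finally have "0 \<le> t1 * (\<integral>x. p x * u x \<partial>?M) - t2 * (\<integral>x. q x * u x \<partial>?M)" using le by simp
    moreover have "t1 * (\<integral>x. p x * u x \<partial>?M) \<le> t1 * (a * P)"
    proof (intro mult_left_mono t)
      have "(\<integral>x. p x * u x \<partial>?M) \<le> (\<integral>x. a * p x \<partial>?M)"
      proof (rule integral_mono_AE)
        show "AE x in ?M. p x * u x \<le> a * p x"
          using pnn by eventually_elim (auto simp: p_def mult.commute[of a] intro: mult_left_mono)
      qed (use iu i in simp_all)
      then show "(\<integral>x. p x * u x \<partial>?M) \<le> a * P" using i by (simp add: P_def)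
    qed
    moreover have "t2 * (b * Q) \<le> t2 * (\<integral>x. q x * u x \<partial>?M)"
    proof (intro mult_left_mono t)
      have "(\<integral>x. b * q x \<partial>?M) \<le> (\<integral>x. q x * u x \<partial>?M)"
      proof (rule integral_mono_AE)
        show "AE x in ?M. b * q x \<le> q x * u x"
          using qnn by eventually_elim (auto simp: q_def mult.commute[of b] intro: mult_left_mono)
      qed (use iu i in simp_all)
      then show "b * Q \<le> (\<integral>x. q x * u x \<partial>?M)" using i by (simp add: Q_def)
    qed
    moreover have "t1 * (a * P) < t2 * (b * Q)"
    proof -
      have "t1 * (a * P) = a * (t1 * P)" by simp
      also have "\<dots> < b * (t1 * P)" using ab mult_pos_pos[OF t(6) pos(1)] by (rule mult_strict_right_mono)
      also have "\<dots> = t2 * (b * Q)" using t(5) by simp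
      finally show ?thesis .
    qed
    ultimately show False by linarith
  qed
  then show ?thesis
  proof
    assume "P = 0"
    then have "AE x in ?M. p x = 0"
      using integral_nonneg_eq_0_iff_AE[OF i(1) pnn] by (simp add: P_def)
    then have "AE x in ?M. \<not> (f x < 1 \<and> u x \<le> a)" by eventually_elim (auto simp: p_def split: if_splits)
    then show ?thesis ..
  next
    assume "Q = 0"
    then have "AE x in ?M. q x = 0"
      using integral_nonneg_eq_0_iff_AE[OF i(2) qnn] by (simp add: Q_def)
    then have "AE x in ?M. \<not> (0 < f x \<and> b \<le> u x)" by eventually_elim (auto simp: q_def split: if_splits)
    then show ?thesis ..
  qed
qed

text \<open>The level is the infimum of those \<open>a\<close> for which f < 1 on a non-null part of
  {u <= a}. Such \<open>a\<close> exist, since otherwise f = 1 a.e. and its integral would be |D| >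
  \<beta>. Below the infimum f = 1 by definition; arbitrarily close above it there are such
  \<open>a\<close>, and the exchange argument then rules out f > 0 at strictly higher values of
  u.\<close>

lemma bathtub:
  assumes \<beta>: "0 < \<beta>" "\<beta> < measure lebesgue D"
    and f: "f \<in> Rbar D \<beta>" and u: "sq_int u"
    and opt: "\<And>g. g \<in> Rbar D \<beta> \<Longrightarrow> (\<integral>x. f x * u x \<partial>lebesgue_on D) \<le> (\<integral>x. g x * u x \<partial>lebesgue_on D)"
    and c: "AE x in lebesgue_on D. c \<le> u x"
  obtains \<alpha> where "c \<le> \<alpha>" "AE x in lebesgue_on D. u x < \<alpha> \<longrightarrow> f x = 1"
    "AE x in lebesgue_on D. \<alpha> < u x \<longrightarrow> f x = 0"
proof -
  let ?M = "lebesgue_on D"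
  have f01: "AE x in ?M. 0 \<le> f x \<and> f x \<le> 1" using f by (simp only: Rbar_iff)
  have intf: "integrable ?M f" by (rule sq_int_integrable[OF sq_int_Rbar[OF f]])
  have intc: "integrable ?M (\<lambda>x. k :: real)" for k by (rule finite_measure.integrable_const[OF finite_measure_D])
  have f\<beta>: "(\<integral>x. f x \<partial>?M) = \<beta>" using f by (simp only: Rbar_iff)
  define S where "S = {a. \<not> (AE x in ?M. \<not> (f x < 1 \<and> u x \<le> a))}"
  have "S \<noteq> {}"
  proof
    assume "S = {}"
    then have "AE x in ?M. \<forall>n::nat. \<not> (f x < 1 \<and> u x \<le> real n)"
      unfolding AE_all_countable S_def by blast
    then have "AE x in ?M. 1 \<le> f x"
    proof eventually_elim
      case (elim x)
      obtain n :: nat where "u x \<le> real n" using real_arch_simple by blast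
      with elim show ?case by (auto simp: not_less)
    qed
    then have "(\<integral>x. 1 \<partial>?M) \<le> (\<integral>x. f x \<partial>?M)" by (intro integral_mono_AE intf intc)
    then show False using integral_const_D[of 1] f\<beta> \<beta> by simp
  qed
  have Sc: "c \<le> a" if "a \<in> S" for a
  proof (rule ccontr)
    assume "\<not> c \<le> a"
    then have "AE x in ?M. \<not> (f x < 1 \<and> u x \<le> a)" using c by (auto elim!: eventually_mono)
    with that show False by (simp add: S_def)
  qed
  then have bdd: "bdd_below S" by (rule bdd_belowI)
  define \<alpha> where "\<alpha> = Inf S"
  show thesis
  proof (rule that)
    show "c \<le> \<alpha>" unfolding \<alpha>_def using \<open>S \<noteq> {}\<close> Sc by (rule cInf_greatest)
    have "AE x in ?M. \<not> (f x < 1 \<and> u x \<le> \<alpha> - 1 / real (Suc n))" for n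
    proof -
      have "\<alpha> - 1 / real (Suc n) \<notin> S"
      proof
        assume "\<alpha> - 1 / real (Suc n) \<in> S"
        then have "\<alpha> \<le> \<alpha> - 1 / real (Suc n)" unfolding \<alpha>_def by (rule cInf_lower) (rule bdd)
        then show False by simp
      qed
      then show ?thesis unfolding S_def by blast
    qed
    then have "AE x in ?M. \<forall>n. \<not> (f x < 1 \<and> u x \<le> \<alpha> - 1 / real (Suc n))"
      unfolding AE_all_countable by blast
    then show "AE x in ?M. u x < \<alpha> \<longrightarrow> f x = 1"
      using f01
    proof eventually_elim
      case (elim x)
      show ?case
      proof
        assume "u x < \<alpha>"
        then obtain n where "inverse (real (Suc n)) < \<alpha> - u x"
          using reals_Archimedean[of "\<alpha> - u x"] by auto
        then have "u x \<le> \<alpha> - 1 / real (Suc n)" by (simp add: inverse_eq_divide)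
        with elim show "f x = 1" by (meson not_less order_antisym)
      qed
    qed
    have "AE x in ?M. \<not> (0 < f x \<and> \<alpha> + 1 / real (Suc n) \<le> u x)" for n
    proof -
      have "Inf S < \<alpha> + 1 / real (Suc n)" by (simp add: \<alpha>_def)
      then obtain a where "a \<in> S" "a < \<alpha> + 1 / real (Suc n)"
        using cInf_lessD[OF \<open>S \<noteq> {}\<close>] by blast
      then show ?thesis using bathtub_exchange[OF f u opt] unfolding S_def by blast
    qed
    then have "AE x in ?M. \<forall>n. \<not> (0 < f x \<and> \<alpha> + 1 / real (Suc n) \<le> u x)"
      unfolding AE_all_countable by blast
    then show "AE x in ?M. \<alpha> < u x \<longrightarrow> f x = 0"
      using f01
    proof eventually_elim
      case (elim x)
      show ?case
      proof
        assume "\<alpha> < u x"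
        then obtain n where "inverse (real (Suc n)) < u x - \<alpha>"
          using reals_Archimedean[of "u x - \<alpha>"] by auto
        then have "\<alpha> + 1 / real (Suc n) \<le> u x" by (simp add: inverse_eq_divide)
        with elim show "f x = 0" by (meson not_less order_antisym)
      qed
    qed
  qed
qed

section \<open>Truncations of the solution as test functions\<close>

lemma form_nonpos_imp_AE_zero:
  assumes v: "v \<in> Hs0 s D" and Q: "gagliardo_form s v v \<le> 0"
  shows "AE x in lebesgue. v x = 0"
proof -
  obtain C where C: "0 < C" "\<And>v. v \<in> Hs0 s D \<Longrightarrow> (\<integral>x. (v x)\<^sup>2 \<partial>lebesgue) \<le> C * gagliardo_form s v v"
    using Poincare by blast
  have "C * gagliardo_form s v v \<le> 0" using C(1) Q by (simp add: mult_nonneg_nonpos)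
  moreover have "0 \<le> (\<integral>x. (v x)\<^sup>2 \<partial>lebesgue)" by simp
  ultimately have "(\<integral>x. (v x)\<^sup>2 \<partial>lebesgue) = 0" using C(2)[OF v] by linarith
  then have "AE x in lebesgue. (v x)\<^sup>2 = 0"
    using v by (subst (asm) integral_nonneg_eq_0_iff_AE) (auto simp: Hs0_def Hs_iff)
  then show ?thesis by simp
qed

text \<open>Integrates a pointwise inequality between increments of a function and of its
  truncation; \<open>c = -1\<close> serves the negative part and \<open>c = 1\<close> the excess
  over a level.\<close>

lemma form_self_le:
  assumes u: "u \<in> Hs s" and v: "v \<in> Hs s"
    and le: "\<And>x y. (v x - v y)\<^sup>2 \<le> c * ((u x - u y) * (v x - v y))"
  shows "gagliardo_form s v v \<le> c * gagliardo_form s u v"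
proof -
  have "(\<integral>z. dquot s v z * dquot s v z \<partial>lebesgue) \<le> (\<integral>z. c * (dquot s u z * dquot s v z) \<partial>lebesgue)"
  proof (rule integral_mono)
    show "dquot s v z * dquot s v z \<le> c * (dquot s u z * dquot s v z)" for z
      using divide_right_mono[OF le[of "fst z" "snd z"]]
      by (simp add: dquot_mult power2_eq_square)
  qed (use integrable_dquot_mult u v in auto)
  then show ?thesis using integrable_dquot_mult[OF u v] by (simp add: gagliardo_form_dquot)
qed

text \<open>Testing with the negative part v of u gives [v,v] <= -[u,v] = -2 (integral of f v) <=
  0.\<close>

lemma solution_nonneg:
  assumes f: "AE x in lebesgue_on D. 0 \<le> f x" and u: "weak_solution s D f u"
  shows "AE x in lebesgue. 0 \<le> u x"
proof -
  note uH = weak_solutionD(1)[OF u]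
  have [measurable]: "u \<in> borel_measurable lebesgue" using uH by (auto simp: Hs0_def Hs_iff)
  define v where "v x = max 0 (- u x)" for x
  have [measurable]: "v \<in> borel_measurable lebesgue" unfolding v_def by measurable
  have v: "v \<in> Hs0 s D"
    by (rule Hs0_contraction[OF uH]) (auto simp: v_def)
  have "gagliardo_form s v v \<le> (-1) * gagliardo_form s u v"
  proof (rule form_self_le[OF uH[THEN Hs0_imp_Hs] v[THEN Hs0_imp_Hs]])
    fix x y
    show "(v x - v y)\<^sup>2 \<le> (-1) * ((u x - u y) * (v x - v y))"
    proof -
      have "0 \<le> (- (u x - u y) - (v x - v y)) * (v x - v y)"
        unfolding v_def by (cases "u x \<le> 0"; cases "u y \<le> 0") (auto simp: mult_nonneg_nonneg mult_nonpos_nonpos mult_nonpos_nonneg mult_nonneg_nonpos)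
      then show ?thesis by (simp add: power2_eq_square algebra_simps)
    qed
  qed
  also have "\<dots> \<le> 0"
  proof -
    have "0 \<le> (\<integral>x. f x * v x \<partial>lebesgue_on D)"
      using f by (intro integral_nonneg_AE) (auto elim!: eventually_mono simp: v_def)
    then show ?thesis using weak_solutionD(2)[OF u v] by simp
  qed
  finally have "AE x in lebesgue. v x = 0" by (rule form_nonpos_imp_AE_zero[OF v])
  then show ?thesis by eventually_elim (auto simp: v_def max_def split: if_splits)
qed

text \<open>The source vanishes wherever v = max(0, u - \<alpha>) does not, so [v,v] <= [u,v] = 0.
  The sign of \<open>\<alpha>\<close> ensures that v is 0 outside D.\<close>

lemma solution_le_level:
  assumes u: "weak_solution s D f u" and \<alpha>: "0 \<le> \<alpha>"
    and f: "AE x in lebesgue_on D. \<alpha> < u x \<longrightarrow> f x = 0"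
  shows "AE x in lebesgue. u x \<le> \<alpha>"
proof -
  note uH = weak_solutionD(1)[OF u]
  have [measurable]: "u \<in> borel_measurable lebesgue" using uH by (auto simp: Hs0_def Hs_iff)
  define v where "v x = max 0 (u x - \<alpha>)" for x
  have [measurable]: "v \<in> borel_measurable lebesgue" unfolding v_def by measurable
  have v: "v \<in> Hs0 s D"
    by (rule Hs0_contraction[OF uH]) (use \<alpha> in \<open>auto simp: v_def\<close>)
  have "gagliardo_form s v v \<le> 1 * gagliardo_form s u v"
  proof (rule form_self_le[OF uH[THEN Hs0_imp_Hs] v[THEN Hs0_imp_Hs]])
    fix x y
    show "(v x - v y)\<^sup>2 \<le> 1 * ((u x - u y) * (v x - v y))"
    proof -
      have "0 \<le> ((u x - u y) - (v x - v y)) * (v x - v y)"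
        unfolding v_def by (cases "u x \<le> \<alpha>"; cases "u y \<le> \<alpha>") (auto simp: mult_nonneg_nonneg mult_nonpos_nonpos mult_nonpos_nonneg mult_nonneg_nonpos)
      then show ?thesis by (simp add: power2_eq_square algebra_simps)
    qed
  qed
  also have "\<dots> = 0"
  proof -
    have "(\<integral>x. f x * v x \<partial>lebesgue_on D) = 0"
    proof (rule integral_eq_zero_AE)
      show "AE x in lebesgue_on D. f x * v x = 0"
        using f by eventually_elim (auto simp: v_def max_def)
    qed
    then show ?thesis using weak_solutionD(2)[OF u v] by simp
  qed
  finally have "AE x in lebesgue. v x = 0" by (intro form_nonpos_imp_AE_zero[OF v]) simp
  then show ?thesis by eventually_elim (auto simp: v_def max_def split: if_splits)
qed

text \<open>On a far ball \<open>A\<close> the function \<open>w - \<alpha>\<close> equals \<open>-\<alpha>\<close>; interactions of its positive part with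
  \<open>A\<close> therefore contribute the extra linear term, which is the nonlocal effect that keeps the
  minimizer positive on the contact set.\<close>

lemma form_positive_part_lower_bound:
  assumes \<alpha>: "0 < \<alpha>"
  obtains c where "0 < c"
    "\<And>w. w \<in> Hs0 s D \<Longrightarrow> (\<lambda>x. max 0 (w x - \<alpha>)) \<in> Hs0 s D \<and>
      gagliardo_form s (\<lambda>x. max 0 (w x - \<alpha>)) (\<lambda>x. max 0 (w x - \<alpha>))
        + c * (\<integral>x. max 0 (w x - \<alpha>) \<partial>lebesgue_on D)
      \<le> gagliardo_form s w (\<lambda>x. max 0 (w x - \<alpha>))"
proof -
  obtain A \<kappa> where A: "A \<in> sets borel" "emeasure lebesgue A = ennreal (measure lebesgue A)"
    "0 < measure lebesgue A" "0 < \<kappa>" "A \<inter> D = {}" "\<And>x y. x \<in> D \<Longrightarrow> y \<in> A \<Longrightarrow> \<kappa> \<le> kernel x y"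
    using ball_off_D by blast
  define m where "m = measure lebesgue A"
  have m: "0 < m" using A by (simp add: m_def)
  show thesis
  \<comment> \<open>Each pair in \<open>D \<times> A\<close> contributes at least
    \<open>\<kappa> * \<alpha> * p x\<close> beyond the square of the increment of \<open>p\<close>;
    integration over \<open>A\<close> gives \<open>m\<close>. The mirrored pairs in
    \<open>A \<times> D\<close> are only estimated from below by the square.\<close>
  proof (rule that[of "\<kappa> * \<alpha> * m"])
    show "0 < \<kappa> * \<alpha> * m" using A \<alpha> m by simp
    fix w assume w: "w \<in> Hs0 s D"
    have [measurable]: "w \<in> borel_measurable lebesgue" using w by (auto simp: Hs0_def Hs_iff)
    have w0: "AE x in lebesgue. x \<notin> D \<longrightarrow> w x = 0" using w by (simp add: Hs0_def)
    define p where "p x = max 0 (w x - \<alpha>)" for x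
    have [measurable]: "p \<in> borel_measurable lebesgue" unfolding p_def by measurable
    have p: "p \<in> Hs0 s D"
      by (rule Hs0_contraction[OF w]) (use \<alpha> in \<open>auto simp: p_def\<close>)
    note H = Hs0_imp_Hs[OF w] Hs0_imp_Hs[OF p]
    define P where "P = (\<integral>x. p x \<partial>lebesgue_on D)"
    have pnn: "0 \<le> p x" for x by (simp add: p_def)
    have P0: "0 \<le> P" by (simp add: P_def pnn)
    have intp: "integrable lebesgue (\<lambda>x. indicator D x * p x)"
      using sq_int_integrable[OF sq_int_Hs0(1)[OF p]] by (simp add: integrable_lebesgue_on_eq)
    define h where "h z = \<kappa> * \<alpha> * (indicator D (fst z) * p (fst z)) * indicator A (snd z)" for z :: "'a \<times> 'a"
    have hm: "h \<in> borel_measurable lebesgue"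
    proof -
      have 1: "(\<lambda>x. \<kappa> * \<alpha> * (indicator D x * p x)) \<in> borel_measurable lebesgue" by measurable
      have 2: "(indicator A :: 'a \<Rightarrow> real) \<in> borel_measurable lebesgue"
        using A(1) by (intro borel_measurable_indicator sets_completionI_sets) simp
      show ?thesis unfolding h_def
        using borel_measurable_lebesgue_fst[OF 1] borel_measurable_lebesgue_snd[OF 2] by (rule borel_measurable_times)
    qed
    have hnn: "0 \<le> h z" for z using A \<alpha> pnn by (simp add: h_def)
    have hI: "(\<integral>\<^sup>+ z. ennreal (h z) \<partial>lebesgue) = ennreal (\<kappa> * \<alpha> * m * P)"
    proof -
      have "(\<integral>\<^sup>+ z. ennreal (h z) \<partial>lebesgue)
          = (\<integral>\<^sup>+ z. ennreal (\<kappa> * \<alpha> * (indicator D (fst z) * p (fst z))) * indicator A (snd z) \<partial>lebesgue)"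
        by (rule nn_integral_cong) (auto simp: h_def indicator_def)
      also have "\<dots> = (\<integral>\<^sup>+ x. ennreal (\<kappa> * \<alpha> * (indicator D x * p x)) \<partial>lebesgue) * emeasure lebesgue A"
        by (rule nn_integral_lebesgue_Times_indicator[OF _ A(1)]) measurable
      also have "(\<integral>\<^sup>+ x. ennreal (\<kappa> * \<alpha> * (indicator D x * p x)) \<partial>lebesgue) = ennreal (\<kappa> * \<alpha> * P)"
        using intp A(4) \<alpha> pnn
        by (subst nn_integral_eq_integral) (auto simp: P_def integral_lebesgue_on_eq)
      also have "ennreal (\<kappa> * \<alpha> * P) * emeasure lebesgue A = ennreal (\<kappa> * \<alpha> * m * P)"
        using A(4) \<alpha> P0 m by (simp add: A(2) m_def[symmetric] ennreal_mult[symmetric] mult.assoc mult.commute)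
      finally show ?thesis .
    qed
    have hint: "integrable lebesgue h"
      using hI hnn by (intro integrableI_nonneg hm) auto
    have hval: "(\<integral>z. h z \<partial>lebesgue) = \<kappa> * \<alpha> * m * P"
      using hI hnn A(4) \<alpha> P0 m by (subst integral_eq_nn_integral[OF hm]) auto
    have "gagliardo_form s p p + \<kappa> * \<alpha> * m * P = (\<integral>z. dquot s p z * dquot s p z + h z \<partial>lebesgue)"
      unfolding hval[symmetric] gagliardo_form_dquot using hint integrable_dquot_mult[OF H(2) H(2)] by simp
    also have "\<dots> \<le> (\<integral>z. dquot s w z * dquot s p z \<partial>lebesgue)"
    proof (rule integral_mono_AE)
      show "integrable lebesgue (\<lambda>z. dquot s p z * dquot s p z + h z)"
        using hint integrable_dquot_mult[OF H(2) H(2)] by simp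
      show "integrable lebesgue (\<lambda>z. dquot s w z * dquot s p z)" by (rule integrable_dquot_mult[OF H])
      show "AE z in lebesgue. dquot s p z * dquot s p z + h z \<le> dquot s w z * dquot s p z"
        using AE_lebesgue_snd[OF w0]
      proof eventually_elim
        case (elim z)
        obtain x y where z: "z = (x, y)" by fastforce
        show ?case
        proof (cases "x \<in> D \<and> y \<in> A")
          case True
          then have y: "w y = 0" using elim A(5) by (auto simp: z)
          then have py: "p y = 0" using \<alpha> by (simp add: p_def)
          have "w x * p x = p x * p x + \<alpha> * p x" by (simp add: p_def max_def algebra_simps)
          then have "dquot s w z * dquot s p z = dquot s p z * dquot s p z + kernel x y * (\<alpha> * p x)"
            by (simp add: dquot_mult z y py add_divide_distrib)
          moreover have "\<kappa> * (\<alpha> * p x) \<le> kernel x y * (\<alpha> * p x)"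
            using True A(6) \<alpha> pnn by (intro mult_right_mono) auto
          ultimately show ?thesis using True by (simp add: h_def z mult.assoc)
        next
          case False
          then have "h z = 0" by (auto simp: h_def z)
          moreover have "(p x - p y) * (p x - p y) \<le> (w x - w y) * (p x - p y)"
          proof -
            have "0 \<le> ((w x - w y) - (p x - p y)) * (p x - p y)"
              unfolding p_def by (cases "w x \<le> \<alpha>"; cases "w y \<le> \<alpha>") (auto simp: mult_nonneg_nonneg mult_nonpos_nonpos mult_nonpos_nonneg mult_nonneg_nonpos)
            then show ?thesis by (simp add: algebra_simps)
          qed
          ultimately show ?thesis by (simp add: dquot_mult z divide_right_mono)
        qed
      qed
    qed
    finally have "gagliardo_form s p p + \<kappa> * \<alpha> * m * P \<le> gagliardo_form s w p"
      by (simp add: gagliardo_form_dquot)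
    with p show "(\<lambda>x. max 0 (w x - \<alpha>)) \<in> Hs0 s D \<and>
      gagliardo_form s (\<lambda>x. max 0 (w x - \<alpha>)) (\<lambda>x. max 0 (w x - \<alpha>))
        + \<kappa> * \<alpha> * m * (\<integral>x. max 0 (w x - \<alpha>) \<partial>lebesgue_on D)
      \<le> gagliardo_form s w (\<lambda>x. max 0 (w x - \<alpha>))"
      unfolding P_def p_def by simp
  qed
qed

text \<open>Testing the equation with \<open>max 0 (\<epsilon> \<phi> + u - \<alpha>) = \<epsilon> max 0 (\<phi> - (\<alpha> - u) / \<epsilon>)\<close> and letting
  \<open>\<epsilon>\<close> tend to 0 localizes it to the contact set \<open>{u = \<alpha>}\<close>.\<close>

lemma source_lower_bound_on_contact_set:
  assumes \<alpha>: "0 < \<alpha>" and fm: "f \<in> borel_measurable (lebesgue_on D)"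
    and f01: "AE x in lebesgue_on D. 0 \<le> f x \<and> f x \<le> 1"
    and u: "weak_solution s D f u" and ule: "AE x in lebesgue. u x \<le> \<alpha>"
  obtains c where "0 < c" "AE x in lebesgue_on D. u x = \<alpha> \<longrightarrow> c \<le> f x"
proof -
  let ?M = "lebesgue_on D"
  let ?B = "gagliardo_form s"
  obtain c where c: "0 < c"
    "\<And>w. w \<in> Hs0 s D \<Longrightarrow> (\<lambda>x. max 0 (w x - \<alpha>)) \<in> Hs0 s D \<and>
      ?B (\<lambda>x. max 0 (w x - \<alpha>)) (\<lambda>x. max 0 (w x - \<alpha>)) + c * (\<integral>x. max 0 (w x - \<alpha>) \<partial>?M)
      \<le> ?B w (\<lambda>x. max 0 (w x - \<alpha>))"
    using form_positive_part_lower_bound[OF \<alpha>] by blast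
  note uH = weak_solutionD(1)[OF u]
  note f[measurable] = fm
  have fS: "sq_int f" by (rule sq_int_unit_bounded[OF f f01])
  have um[measurable]: "u \<in> borel_measurable ?M" using sq_int_Hs0(1)[OF uH] by (simp add: sq_int_def)
  \<comment> \<open>By \<open>ule\<close> the condition means \<open>u x = \<alpha>\<close> a.e. The
    2 comes from the factor 1/2 in the weak equation, so \<open>h \<le> 0\<close> yields
    \<open>c / 2\<close> as lower bound for f.\<close>
  define h where "h x = (if \<alpha> \<le> u x then c - 2 * f x else 0)" for x
  have hm: "h \<in> borel_measurable ?M" unfolding h_def by measurable
  have "AE x in ?M. h x \<le> 0"
  proof (rule AE_nonpos_if_tested[OF hm])
    show "AE x in ?M. \<bar>h x\<bar> \<le> c + 2"
      using f01 by eventually_elim (use c(1) in \<open>auto simp: h_def\<close>)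
    fix \<phi> assume \<phi>: "\<phi> \<in> Hs0 s D" "\<And>x. 0 \<le> \<phi> x" "\<And>x. \<phi> x \<le> 1"
    have [measurable]: "\<phi> \<in> borel_measurable ?M" using sq_int_Hs0(1)[OF \<phi>(1)] by (simp add: sq_int_def)
    define e where "e k = 1 / real (Suc k)" for k
    have e: "0 < e k" "e k \<le> 1" for k by (auto simp: e_def)
    define w where "w k x = e k * \<phi> x + 1 * u x" for k x
    have w: "w k \<in> Hs0 s D" for k unfolding w_def by (rule Hs0_lincomb[OF \<phi>(1) uH])
    define p where "p k x = max 0 (w k x - \<alpha>)" for k x
    have p: "p k \<in> Hs0 s D" for k using c(2)[OF w[of k]] unfolding p_def by blast
    have [measurable]: "p k \<in> borel_measurable ?M" for k using sq_int_Hs0(1)[OF p[of k]] by (simp add: sq_int_def)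
    \<comment> \<open>Dividing by \<open>e k\<close> keeps the test function below
      \<open>\<phi>\<close>, because u <= \<alpha>; as \<open>e k\<close> tends to 0 it converges to
      \<open>\<phi>\<close> on the contact set and to 0 elsewhere.\<close>
    define q where "q k x = max 0 (\<phi> x + (u x - \<alpha>) / e k)" for k x
    have pq: "p k x = e k * q k x" for k x
    proof -
      have "w k x - \<alpha> = e k * (\<phi> x + (u x - \<alpha>) / e k)"
        using e(1)[of k] by (simp add: w_def distrib_left)
      then show ?thesis
        unfolding p_def q_def using e(1)[of k] by (simp add: max_mult_distrib_left)
    qed
    have [measurable]: "q k \<in> borel_measurable ?M" for k unfolding q_def by measurable
    have q01: "AE x in ?M. 0 \<le> q k x \<and> q k x \<le> \<phi> x" for k
      using AE_on_D[OF ule]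
    proof eventually_elim
      case (elim x)
      have "(u x - \<alpha>) / e k \<le> 0" using elim e(1)[of k] by (simp add: divide_nonpos_pos)
      then show ?case using \<phi>(2)[of x] by (simp add: q_def)
    qed
    have q01': "AE x in ?M. 0 \<le> q k x \<and> q k x \<le> 1" for k
      using q01[of k] by eventually_elim (use \<phi>(3) order_trans in blast)
    have qS: "sq_int (q k)" for k by (rule sq_int_unit_bounded[OF _ q01']) simp
    define X where "X k = (\<integral>x. (c - 2 * f x) * q k x \<partial>?M)" for k
    have Xeq: "e k * X k = c * (\<integral>x. p k x \<partial>?M) - 2 * (\<integral>x. f x * p k x \<partial>?M)" for k
    proof -
      have "X k = c * (\<integral>x. q k x \<partial>?M) - 2 * (\<integral>x. f x * q k x \<partial>?M)"
        unfolding X_def using sq_int_integrable[OF qS[of k]] sq_int_mult[OF fS qS[of k]]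
        by (simp add: left_diff_distrib mult.assoc)
      then show ?thesis unfolding pq by (simp add: right_diff_distrib mult.left_commute)
    qed
    have main: "?B (p k) (p k) + e k * X k \<le> e k * ?B \<phi> (p k)" for k
    proof -
      have "?B (p k) (p k) + c * (\<integral>x. p k x \<partial>?M) \<le> ?B (w k) (p k)"
        using c(2)[OF w[of k]] unfolding p_def by blast
      also have "?B (w k) (p k) = e k * ?B \<phi> (p k) + 1 * ?B u (p k)"
        unfolding w_def by (rule gagliardo_form_lincomb[OF Hs0_imp_Hs[OF \<phi>(1)] Hs0_imp_Hs[OF uH] Hs0_imp_Hs[OF p]])
      also have "?B u (p k) = 2 * (\<integral>x. f x * p k x \<partial>?M)" by (rule weak_solutionD(2)[OF u p])
      finally show ?thesis unfolding Xeq by simp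
    qed
    have XB: "X k \<le> ?B \<phi> (p k)" for k
    proof -
      have "e k * X k \<le> e k * ?B \<phi> (p k)" using main[of k] gagliardo_form_self_nonneg[of s "p k"] by linarith
      then show ?thesis using e(1)[of k] by simp
    qed
    \<comment> \<open>In \<open>main\<close>, \<open>X k\<close> is at least -2 |D|, and the mixed
      term is at most half the sum of the two squares. As \<open>e k \<le> 1\<close>, half of the
      form of \<open>p k\<close> is absorbed on the left, and doubling what remains gives
      \<open>K\<close>. So \<open>p k\<close> tends to 0 in energy, and with it the mixed term that
      bounds \<open>X k\<close>.\<close>
    define K where "K = 4 * measure lebesgue D + ?B \<phi> \<phi>"
    have Bp: "?B (p k) (p k) \<le> e k * K" for k
    proof -
      have "- 2 * measure lebesgue D \<le> X k"
      proof -
        have "(\<integral>x. - 2 \<partial>?M) \<le> X k" unfolding X_def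
        proof (rule integral_mono_AE)
          show "integrable ?M (\<lambda>x. - 2 :: real)" by (rule finite_measure.integrable_const[OF finite_measure_D])
          show "integrable ?M (\<lambda>x. (c - 2 * f x) * q k x)"
            using sq_int_integrable[OF qS[of k]] sq_int_mult[OF fS qS[of k]]
            by (simp add: left_diff_distrib mult.assoc)
          show "AE x in ?M. - 2 \<le> (c - 2 * f x) * q k x"
            using q01'[of k] f01
          proof eventually_elim
            case (elim x)
            have "f x * q k x \<le> 1 * 1" using elim by (intro mult_mono) auto
            moreover have "0 \<le> c * q k x" using elim c(1) by simp
            ultimately show ?case by (simp add: left_diff_distrib mult.assoc)
          qed
        qed
        then show ?thesis using integral_const_D[of "- 2"] by simp
      qed
      then have "e k * (- 2 * measure lebesgue D) \<le> e k * X k"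
        using less_imp_le[OF e(1)] by (rule mult_left_mono)
      moreover have "2 * ?B \<phi> (p k) \<le> ?B \<phi> \<phi> + ?B (p k) (p k)"
        using gagliardo_form_self_lincomb[OF Hs0_imp_Hs[OF \<phi>(1)] Hs0_imp_Hs[OF p[of k]], of 1 "-1"]
          gagliardo_form_self_nonneg[of s "\<lambda>x. 1 * \<phi> x + (-1) * p k x"] by simp
      then have "e k * (2 * ?B \<phi> (p k)) \<le> e k * (?B \<phi> \<phi> + ?B (p k) (p k))"
        using less_imp_le[OF e(1)] by (rule mult_left_mono)
      moreover have "e k * ?B (p k) (p k) \<le> 1 * ?B (p k) (p k)"
        by (intro mult_right_mono e gagliardo_form_self_nonneg)
      ultimately show ?thesis using main[of k] unfolding K_def by (simp add: algebra_simps)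
    qed
    have e0: "e \<longlonglongrightarrow> 0"
      unfolding e_def using LIMSEQ_inverse_real_of_nat by (simp add: inverse_eq_divide)
    have Xle: "X k \<le> sqrt (?B \<phi> \<phi> * (e k * K))" for k
    proof -
      have "(?B \<phi> (p k))\<^sup>2 \<le> ?B \<phi> \<phi> * ?B (p k) (p k)"
        by (rule gagliardo_form_Cauchy_Schwarz[OF Hs0_imp_Hs[OF \<phi>(1)] Hs0_imp_Hs[OF p]])
      also have "\<dots> \<le> ?B \<phi> \<phi> * (e k * K)" by (intro mult_left_mono Bp gagliardo_form_self_nonneg)
      finally have "?B \<phi> (p k) \<le> sqrt (?B \<phi> \<phi> * (e k * K))" by (rule real_le_rsqrt)
      with XB[of k] show ?thesis by linarith
    qed
    have "(\<lambda>k. sqrt (?B \<phi> \<phi> * (e k * K))) \<longlonglongrightarrow> sqrt (?B \<phi> \<phi> * (0 * K))"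
      by (intro tendsto_intros e0)
    moreover have "X \<longlonglongrightarrow> (\<integral>x. h x * \<phi> x \<partial>?M)"
      unfolding X_def
    proof (rule integral_dominated_convergence[where w = "\<lambda>x. c + 2"])
      show "(\<lambda>x. h x * \<phi> x) \<in> borel_measurable ?M" using hm by measurable
      show "integrable ?M (\<lambda>x. c + 2)" by (rule finite_measure.integrable_const[OF finite_measure_D])
      show "AE x in ?M. norm ((c - 2 * f x) * q k x) \<le> c + 2" for k
        using q01'[of k] f01
      proof eventually_elim
        case (elim x)
        have "\<bar>c - 2 * f x\<bar> * \<bar>q k x\<bar> \<le> (c + 2) * 1"
          using elim c(1) by (intro mult_mono) auto
        then show ?case by (simp add: abs_mult)
      qed
      show "AE x in ?M. (\<lambda>k. (c - 2 * f x) * q k x) \<longlonglongrightarrow> h x * \<phi> x"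
        using AE_on_D[OF ule]
      proof eventually_elim
        case (elim x)
        show ?case
        proof (cases "u x = \<alpha>")
          case True
          then have "q k x = \<phi> x" for k using \<phi>(2)[of x] by (simp add: q_def)
          then show ?thesis using True by (simp add: h_def)
        next
          case False
          with elim have lt: "0 < \<alpha> - u x" by simp
          obtain N where N: "1 < real N * (\<alpha> - u x)" using ex_less_of_nat_mult[OF lt] by blast
          have "q k x = 0" if "N \<le> k" for k
          proof -
            have "real N * (\<alpha> - u x) \<le> real (Suc k) * (\<alpha> - u x)"
              using that lt by (intro mult_right_mono) auto
            then have "1 \<le> real (Suc k) * (\<alpha> - u x)" using N by linarith
            moreover have "(u x - \<alpha>) / e k = - (real (Suc k) * (\<alpha> - u x))"
              by (simp add: e_def algebra_simps)
            ultimately show ?thesis using \<phi>(3)[of x] by (simp add: q_def)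
          qed
          then have "eventually (\<lambda>k. (c - 2 * f x) * q k x = 0) sequentially"
            by (auto simp: eventually_sequentially)
          then have "(\<lambda>k. (c - 2 * f x) * q k x) \<longlonglongrightarrow> 0" by (rule tendsto_eventually)
          then show ?thesis using lt by (simp add: h_def)
        qed
      qed
    qed measurable
    ultimately have "(\<integral>x. h x * \<phi> x \<partial>?M) \<le> sqrt (?B \<phi> \<phi> * (0 * K))"
      using Xle by (intro LIMSEQ_le) auto
    then show "(\<integral>x. h x * \<phi> x \<partial>?M) \<le> 0" by simp
  qed
  then have "AE x in ?M. u x = \<alpha> \<longrightarrow> c / 2 \<le> f x"
    by eventually_elim (auto simp: h_def split: if_splits)
  then show thesis using c(1) by (intro that[of "c / 2"]) auto
qed

lemma minimizer_structure:
  assumes \<beta>: "0 < \<beta>" "\<beta> < measure lebesgue D" and f: "minimizer s D \<beta> f"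
  obtains \<alpha> where "0 < \<alpha>"
    "AE x in lebesgue_on D. solution s D f x < \<alpha> \<longrightarrow> f x = 1"
    "AE x in lebesgue_on D. 0 < f x"
    "AE x in lebesgue_on D. 0 \<le> solution s D f x \<and> solution s D f x \<le> \<alpha>"
proof -
  let ?M = "lebesgue_on D" and ?u = "solution s D f"
  have R: "f \<in> Rbar D \<beta>" using f by (simp add: minimizer_iff)
  have fm: "f \<in> borel_measurable ?M" and f01: "AE x in ?M. 0 \<le> f x \<and> f x \<le> 1"
    and f\<beta>: "(\<integral>x. f x \<partial>?M) = \<beta>" using R unfolding Rbar_iff by blast+
  have f0: "AE x in ?M. 0 \<le> f x" using f01 by eventually_elim simp
  have u: "weak_solution s D f ?u" by (rule weak_solution_solution[OF sq_int_Rbar[OF R]])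
  note uH = weak_solutionD(1)[OF u]
  have u0: "AE x in lebesgue. 0 \<le> ?u x" by (rule solution_nonneg[OF f0 u])
  obtain \<alpha> where \<alpha>: "0 \<le> \<alpha>" "AE x in ?M. ?u x < \<alpha> \<longrightarrow> f x = 1" "AE x in ?M. \<alpha> < ?u x \<longrightarrow> f x = 0"
    using bathtub[OF \<beta> R sq_int_Hs0(1)[OF uH] minimizer_first_order[OF f] AE_on_D[OF u0]] by blast
  have ule: "AE x in lebesgue. ?u x \<le> \<alpha>" by (rule solution_le_level[OF u \<alpha>(1,3)])
  have "\<alpha> \<noteq> 0"
  proof
    assume "\<alpha> = 0"
    have "AE x in ?M. f x * ?u x = 0"
      using AE_on_D[OF u0] AE_on_D[OF ule] by eventually_elim (simp add: \<open>\<alpha> = 0\<close>)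
    then have "gagliardo_form s ?u ?u \<le> 0"
      using weak_solutionD(2)[OF u uH] by (simp add: integral_eq_zero_AE)
    moreover have "AE x in ?M. \<bar>f x\<bar> \<le> 1" using f01 by eventually_elim auto
    ultimately have "AE x in ?M. f x = 0" by (intro form_zero_imp_zero[OF fm _ u])
    then show False using f\<beta> \<beta>(1) by (simp add: integral_eq_zero_AE)
  qed
  with \<alpha>(1) have pos: "0 < \<alpha>" by simp
  obtain c where c: "0 < c" "AE x in ?M. ?u x = \<alpha> \<longrightarrow> c \<le> f x"
    using source_lower_bound_on_contact_set[OF pos fm f01 u ule] by blast
  \<comment> \<open>Since u <= \<alpha>, a point lies either below the level, where f = 1, or on it,
    where f >= c.\<close>
  have "AE x in ?M. 0 < f x"
    using AE_on_D[OF ule] \<alpha>(2) c(2) by eventually_elim (use c(1) in auto)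
  moreover have "AE x in ?M. 0 \<le> ?u x \<and> ?u x \<le> \<alpha>"
    using AE_on_D[OF u0] AE_on_D[OF ule] by eventually_elim simp
  ultimately show thesis using pos \<alpha>(2) by (intro that)
qed

text \<open>A characteristic function that is positive a.e. in D equals 1 there, and its integral
  would be |D| > \<beta>.\<close>

lemma positive_not_in_Rchar:
  assumes \<beta>: "\<beta> < measure lebesgue D" and f: "f \<in> Rbar D \<beta>" and pos: "AE x in lebesgue_on D. 0 < f x"
  shows "f \<notin> Rchar D \<beta>"
proof
  assume "f \<in> Rchar D \<beta>"
  then obtain E where "AE x in lebesgue_on D. f x = indicator E x" by (auto simp: Rchar_def)
  then have one: "AE x in lebesgue_on D. f x = 1"
    using pos by eventually_elim (auto simp: indicator_def split: if_splits)
  have "(\<integral>x. f x \<partial>lebesgue_on D) = (\<integral>x. 1 \<partial>lebesgue_on D)"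
    using f by (intro integral_cong_AE one) (auto simp: Rbar_iff)
  then show False using f \<beta> integral_const_D[of 1] by (simp add: Rbar_iff)
qed

end

theorem theorem3p1:
  fixes D :: "'a::euclidean_space set" and s \<beta> :: real
  assumes "0 < s" and "s < 1"
    and "open D" and "connected D" and "bounded D"
    and "0 < \<beta>" and "\<beta> < measure lebesgue D"
  shows "\<exists>fhat. minimizer s D \<beta> fhat
    \<and> (\<forall>g. minimizer s D \<beta> g \<longrightarrow> (AE x in lebesgue_on D. g x = fhat x))
    \<and> fhat \<in> Rbar D \<beta> - Rchar D \<beta>
    \<and> (\<exists>\<alpha>>0.
          (AE x in lebesgue_on D. fhat x < 1 \<longrightarrow> solution s D fhat x = \<alpha>)
        \<and> (AE x in lebesgue_on D. solution s D fhat x < \<alpha> \<longrightarrow> fhat x = 1)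
        \<and> (AE x in lebesgue_on D. 0 < fhat x)
        \<and> (AE x in lebesgue_on D. 0 \<le> solution s D fhat x \<and> solution s D fhat x \<le> \<alpha>))"
proof -
  interpret bounded_open_set D s using assms by unfold_locales
  note \<beta> = \<open>0 < \<beta>\<close> \<open>\<beta> < measure lebesgue D\<close>
  obtain f where f: "minimizer s D \<beta> f" using minimizer_exists[OF \<beta>] by blast
  obtain \<alpha> where \<alpha>: "0 < \<alpha>"
    "AE x in lebesgue_on D. solution s D f x < \<alpha> \<longrightarrow> f x = 1"
    "AE x in lebesgue_on D. 0 < f x"
    "AE x in lebesgue_on D. 0 \<le> solution s D f x \<and> solution s D f x \<le> \<alpha>"
    using minimizer_structure[OF \<beta> f] by blast
  have "AE x in lebesgue_on D. f x < 1 \<longrightarrow> solution s D f x = \<alpha>"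
    using \<alpha>(2,4) by eventually_elim force
  moreover have "f \<in> Rbar D \<beta> - Rchar D \<beta>"
    using f positive_not_in_Rchar[OF \<beta>(2) _ \<alpha>(3)] by (simp add: minimizer_iff)
  ultimately show ?thesis using f \<alpha> minimizer_unique[OF f] by blast
qed

end
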